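(* Let $n$ be a positive integer with $n \geq 2$. Then the only solutions in positive integers $x, y, z$ of the exponential Diophantine equation $$(n-1)^{x}+(n+2)^{y}=n^{z}$$ are $(n,x,y,z)=(3,2,1,2)$ and $(n,x,y,z)=(3,1,2,3)$. *)

theory Defs
  imports Main
begin

end

theory Submission
  imports Defs "HOL-Number_Theory.Number_Theory" "HOL-Computational_Algebra.Nth_Powers"
    "HOL-Library.Discrete_Functions" "HOL-Analysis.Complex_Transcendental"
begin

text \<open>Congruences modulo \<open>4\<close>, \<open>n\<close> and \<open>n + 1\<close> leave two kinds of solutions with \<open>n > 3\<close>. If \<open>z\<close> is
  even, then \<open>n = 2 ^ r - 1\<close>, both \<open>y\<close> and \<open>z\<close> are even, and factoring the difference of squares
  \<open>n ^ z - (n + 2) ^ y\<close> leads to a contradiction. Otherwise \<open>y\<close> is even and \<open>z\<close> is odd. If then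
  \<open>x\<close> is even, the equation is a sum of two squares, its two terms come from the \<open>z\<close>-th power of a
  Gaussian integer of norm \<open>n\<close>, and the power of two dividing \<open>n - 1\<close> forces \<open>4 ^ x < n\<close>, whereas
  \<open>n + 1\<close> divides \<open>2 ^ x + 2\<close>.

  If \<open>x\<close> and \<open>z\<close> are odd and \<open>y\<close> is even, put \<open>D = n - 1\<close>. The equation reads \<open>B\<^sup>2 + D A\<^sup>2 = n ^ z\<close> with
  \<open>A\<close> a power of \<open>D\<close>. A size estimate gives \<open>z \<ge> D - 1\<close>, which exceeds the number of reduced forms
  of discriminant \<open>- 4 D\<close>. Hence, by the pigeonhole principle, \<open>B + A sqrt (- D)\<close> is up to sign
  a \<open>q\<close>-th power of some \<open>X + Y sqrt (- D)\<close> with an odd prime \<open>q\<close>. The corresponding Lucas number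
  of index \<open>q\<close> divides a power of \<open>D\<close>, so it is \<open>1\<close>, \<open>- 1\<close>, \<open>q\<close> or \<open>- q\<close>. Valuations
  at a prime divisor of \<open>D\<close> exclude \<open>1\<close> and \<open>q\<close>, and congruences modulo \<open>3\<close>, \<open>4\<close> and \<open>8\<close> exclude
  the negative values, except for \<open>n = 5\<close> modulo \<open>24\<close>; in that case \<open>6\<close> would be a square modulo
  \<open>n + 2\<close>.\<close>

section \<open>Reduced lattice bases\<close>

text \<open>Multiplicativity of the norm, for \<open>u + v sqrt (- D)\<close> times the conjugate of
  \<open>s + t sqrt (- D)\<close>.\<close>

lemma norm_mult_identity:
  fixes u v s t D :: int
  shows "(u * s + D * v * t)\<^sup>2 + D * (v * s - u * t)\<^sup>2 = (u\<^sup>2 + D * v\<^sup>2) * (s\<^sup>2 + D * t\<^sup>2)"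
  by (simp add: algebra_simps power2_eq_square)

text \<open>A pair \<open>(u, v)\<close> stands for \<open>u + v sqrt (- D)\<close>. The pairs \<open>(u, v)\<close> and \<open>(u', v')\<close> lie in the
  lattice of all pairs with \<open>u = l v\<close> modulo \<open>N\<close>, the norm form of the lattice divided by \<open>N\<close> is
  \<open>(P, 2 Q, R)\<close> in this basis, and the quotient of the second basis element by the first is
  \<open>(Q + sqrt (- D)) / P\<close>. Hence lattices with equal \<open>P\<close> and \<open>Q\<close> differ by a factor of
  the field only.\<close>
definition lattice_basis :: "int \<Rightarrow> int \<Rightarrow> int \<Rightarrow> int \<Rightarrow> int \<Rightarrow> int \<Rightarrow> int \<Rightarrow> int \<Rightarrow> int \<Rightarrow> int \<Rightarrow> bool" where
  "lattice_basis D N l P Q R u v u' v' \<longleftrightarrow>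
    P > 0 \<and> N dvd u - l * v \<and> N dvd u' - l * v' \<and> u\<^sup>2 + D * v\<^sup>2 = P * N \<and>
    P * u' = Q * u - D * v \<and> P * v' = Q * v + u \<and> P * R = Q\<^sup>2 + D"

text \<open>With \<open>lattice_basis_swap\<close>, this is the action of the generators of the
  modular group: the quotient \<open>(Q + sqrt (- D)) / P\<close> is translated by
  \<open>k\<close>.\<close>

lemma lattice_basis_shift:
  assumes "lattice_basis D N l P Q R u v u' v'"
  shows "lattice_basis D N l P (Q + k * P) (R + 2 * k * Q + k\<^sup>2 * P) u v (u' + k * u) (v' + k * v)"
proof -
  have "N dvd (u' - l * v') + k * (u - l * v)"
    using assms by (auto simp: lattice_basis_def)
  then show ?thesis
    using assms by (auto simp: lattice_basis_def algebra_simps power2_eq_square)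
qed

text \<open>The quotient \<open>(Q + sqrt (- D)) / P\<close> goes to its negative reciprocal
  \<open>(- Q + sqrt (- D)) / R\<close>.\<close>

lemma lattice_basis_swap:
  assumes "lattice_basis D N l P Q R u v u' v'" "D > 0" "N > 0"
  shows "lattice_basis D N l R (- Q) P u' v' (- u) (- v)"
proof -
  have h: "P > 0" "u\<^sup>2 + D * v\<^sup>2 = P * N" "P * u' = Q * u - D * v" "P * v' = Q * v + u"
      "P * R = Q\<^sup>2 + D" "N dvd u - l * v" "N dvd u' - l * v'"
    using assms(1) by (auto simp: lattice_basis_def)
  have "R > 0" using h(1,5) assms(2)
    by (smt (verit) mult_nonneg_nonpos zero_le_power2)
  have "P * (P * (u'\<^sup>2 + D * v'\<^sup>2)) = (P * u')\<^sup>2 + D * (P * v')\<^sup>2" by (simp add: algebra_simps power2_eq_square)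
  also have "\<dots> = (Q\<^sup>2 + D) * (u\<^sup>2 + D * v\<^sup>2)" unfolding h(3,4) by (simp add: algebra_simps power2_eq_square)
  also have "\<dots> = P * (P * (R * N))" unfolding h(2) h(5)[symmetric] by (simp add: algebra_simps power2_eq_square)
  finally have n: "u'\<^sup>2 + D * v'\<^sup>2 = R * N" using h(1) by simp
  have "P * (R * u) = (Q\<^sup>2 + D) * u" using h(5) by (simp flip: h(5))
  also have "\<dots> = Q * (P * u') + D * (P * v')" unfolding h(3,4) by (simp add: algebra_simps power2_eq_square)
  also have "\<dots> = P * (Q * u' + D * v')" by (simp add: algebra_simps)
  finally have a: "R * u = Q * u' + D * v'" using h(1) by simp
  have "P * (R * v) = (Q\<^sup>2 + D) * v" using h(5) by (simp flip: h(5))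
  also have "\<dots> = Q * (P * v') - P * u'" unfolding h(3,4) by (simp add: algebra_simps power2_eq_square)
  also have "\<dots> = P * (Q * v' - u')" by (simp add: algebra_simps)
  finally have b: "R * v = Q * v' - u'" using h(1) by simp
  have "N dvd - (u - l * v)" using h(6) by (rule dvd_minus_iff[THEN iffD2])
  then have c: "N dvd - u - l * (- v)" by simp
  show ?thesis unfolding lattice_basis_def
    using \<open>R > 0\<close> n a b c h by (auto simp: mult.commute)
qed

text \<open>Gauss reduction: \<open>P\<close> is taken minimal and \<open>Q\<close> is shifted to
  absolute value at most \<open>P / 2\<close>. Swapping the basis shows \<open>P <= R\<close>, so
  \<open>P * P <= P * R = Q * Q + D\<close>, which bounds \<open>P\<close>.\<close>

lemma reduced_lattice_basis:
  fixes D N l :: int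
  assumes "D > 0" "N > 0" "N dvd l\<^sup>2 + D"
  obtains P Q R u v u' v' where "lattice_basis D N l P Q R u v u' v'"
    "- P < 2 * Q" "2 * Q \<le> P" "3 * P\<^sup>2 \<le> 4 * D"
proof -
  let ?S = "\<lambda>p. \<exists>Q R u v u' v'. lattice_basis D N l (int p) Q R u v u' v'"
  obtain c where c: "l\<^sup>2 + D = N * c" using assms(3) by auto
  have "lattice_basis D N l (int (nat N)) l c N 0 l 1"
    using assms c by (auto simp: lattice_basis_def power2_eq_square)
  then have ex: "?S (nat N)" by blast
  define p where "p = (LEAST p. ?S p)"
  have "?S p" unfolding p_def using ex by (rule LeastI)
  then obtain Q R u v u' v' where b: "lattice_basis D N l (int p) Q R u v u' v'" by blast
  define P where "P = int p"
  have P: "P > 0" using b by (auto simp: lattice_basis_def P_def)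
  \<comment> \<open>Rounding such that \<open>Q'\<close> lands in the half-open interval from
    \<open>- P / 2\<close> (excluded) to \<open>P / 2\<close>.\<close>
  define k where "k = - ((2 * Q + P - 1) div (2 * P))"
  define Q' where "Q' = Q + k * P"
  define R' where "R' = R + 2 * k * Q + k\<^sup>2 * P"
  have b': "lattice_basis D N l P Q' R' u v (u' + k * u) (v' + k * v)"
    using lattice_basis_shift[OF b, of k] by (simp add: Q'_def R'_def P_def)
  have "2 * Q' + P - 1 = (2 * Q + P - 1) mod (2 * P)"
    unfolding Q'_def k_def by (simp add: algebra_simps minus_div_mult_eq_mod[symmetric])
  then have q: "0 \<le> 2 * Q' + P - 1" "2 * Q' + P - 1 < 2 * P" using P by auto
  have sw: "lattice_basis D N l R' (- Q') P (u' + k * u) (v' + k * v) (- u) (- v)"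
    by (rule lattice_basis_swap[OF b' assms(1,2)])
  have "R' > 0" using sw by (auto simp: lattice_basis_def)
  then have "int (nat R') = R'" by simp
  then have "?S (nat R')" using sw by metis
  then have "p \<le> nat R'" unfolding p_def by (rule Least_le)
  then have "P \<le> R'" using \<open>R' > 0\<close> by (simp add: P_def)
  then have "P * P \<le> P * R'" using P by simp
  also have "\<dots> = Q'\<^sup>2 + D" using b' by (auto simp: lattice_basis_def)
  finally have 1: "P * P \<le> Q'\<^sup>2 + D" .
  have "\<bar>2 * Q'\<bar> \<le> \<bar>P\<bar>" using q P by auto
  then have "(2 * Q')\<^sup>2 \<le> P\<^sup>2" by (simp only: abs_le_square_iff)
  then have "3 * P\<^sup>2 \<le> 4 * D" using 1 by (auto simp: power2_eq_square)
  with b' q show ?thesis using that by force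
qed

text \<open>The form \<open>(P, 2 Q, R)\<close> represents \<open>N\<close> and has discriminant
  \<open>- 4 D\<close>, so a common divisor of its coefficients divides both \<open>N\<close> and
  \<open>4 D\<close>.\<close>

lemma lattice_basis_primitive:
  assumes "lattice_basis D N l P Q R u v u' v'" "coprime N (2 * D)"
  obtains x y z where "x * P + y * (2 * Q) + z * R = 1"
proof -
  have h: "P > 0" "u\<^sup>2 + D * v\<^sup>2 = P * N" "P * v' = Q * v + u" "P * R = Q\<^sup>2 + D"
    using assms(1) by (auto simp: lattice_basis_def)
  have "P * (P * v'\<^sup>2 - (2 * Q) * v * v' + R * v\<^sup>2) = P * N"
  proof -
    have "P * (P * v'\<^sup>2 - (2 * Q) * v * v' + R * v\<^sup>2) = (P * v' - Q * v)\<^sup>2 + (P * R - Q\<^sup>2) * v\<^sup>2"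
      by (simp add: algebra_simps power2_eq_square)
    then show ?thesis using h(2) unfolding h(3,4) by simp
  qed
  then have N: "N = P * v'\<^sup>2 - (2 * Q) * v * v' + R * v\<^sup>2" using h(1) by simp
  define g where "g = gcd (gcd P (2 * Q)) R"
  have g: "g dvd P" "g dvd 2 * Q" "g dvd R" by (auto simp: g_def intro: dvd_trans)
  have gN: "g dvd N" unfolding N using g by (intro dvd_add dvd_diff) (auto intro: dvd_mult2)
  have "4 * D = 4 * (P * R) - (2 * Q) * (2 * Q)" unfolding h(4) by (simp add: algebra_simps power2_eq_square)
  moreover have "g dvd 4 * (P * R) - (2 * Q) * (2 * Q)"
    by (rule dvd_diff[OF dvd_mult[OF dvd_mult2[OF g(1)]] dvd_mult[OF g(2)]])
  ultimately have "g dvd 4 * D" by simp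
  moreover have "coprime N (4 * D)" using assms(2)
    by (metis coprime_mult_right_iff mult_2 numeral_Bit0 distrib_right)
  ultimately have "g dvd 1" using gN by (meson coprime_common_divisor)
  then have "gcd (gcd P (2 * Q)) R = 1" unfolding g_def by simp
  obtain a b where ab: "a * gcd P (2 * Q) + b * R = 1"
    using bezout_int[of "gcd P (2 * Q)" R] \<open>gcd (gcd P (2 * Q)) R = 1\<close> by auto
  obtain c d where cd: "c * P + d * (2 * Q) = gcd P (2 * Q)"
    using bezout_int[of P "2 * Q"] by auto
  have "(a * c) * P + (a * d) * (2 * Q) + b * R = 1"
    using ab unfolding cd[symmetric] by (simp add: algebra_simps)
  then show ?thesis using that by blast
qed

text \<open>The lattice of level \<open>n ^ j\<close> behaves like the \<open>j\<close>-th power of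
  an ideal of norm \<open>n\<close>: times the conjugate of the \<open>i\<close>-th power it is
  divisible by \<open>n ^ i\<close>, and the quotient lies in level
  \<open>n ^ (j - i)\<close>.\<close>

lemma lattice_conj_product:
  fixes n l D u v s t :: int
  assumes "n ^ j dvd l\<^sup>2 + D" "i \<le> j" "n \<noteq> 0" "n ^ j dvd u - l * v" "n ^ i dvd s - l * t"
  obtains x y where "u * s + D * v * t = n ^ i * x" "v * s - u * t = n ^ i * y"
    "n ^ (j - i) dvd x - l * y"
proof -
  obtain c where c: "s = l * t + n ^ i * c" using assms(5) by (metis dvdE add_diff_cancel_left' diff_add_cancel add.commute)
  obtain d where d: "u = l * v + n ^ j * d" using assms(4) by (metis dvdE diff_add_cancel add.commute)
  obtain e where e: "l\<^sup>2 + D = n ^ j * e" using assms(1) by auto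
  have nj: "n ^ j = n ^ i * n ^ (j - i)" using assms(2) by (simp flip: power_add)
  let ?y = "v * c - n ^ (j - i) * d * t"
  let ?x = "l * v * c + n ^ (j - i) * (e * v * t + d * l * t + d * n ^ i * c)"
  have "u * s + D * v * t = n ^ i * ?x"
  proof -
    have "u * s + D * v * t = (l\<^sup>2 + D) * (v * t) + l * v * n ^ i * c + n ^ j * d * (l * t + n ^ i * c)"
      unfolding c d by (simp add: algebra_simps power2_eq_square)
    then show ?thesis unfolding e nj by (simp add: algebra_simps)
  qed
  moreover have "v * s - u * t = n ^ i * ?y" unfolding c d nj by (simp add: algebra_simps)
  moreover have "?x - l * ?y = n ^ (j - i) * (e * v * t + 2 * d * l * t + d * n ^ i * c)" by (simp add: algebra_simps)
  ultimately show ?thesis using that by (metis dvd_triv_left)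
qed

lemma same_shape_gives_element:
  fixes n l D :: int
  assumes "n > 0" "coprime n (2 * D)" "i \<le> j" "n ^ j dvd l\<^sup>2 + D"
    and e: "lattice_basis D (n ^ j) l P Q R u v u' v'"
    and f: "lattice_basis D (n ^ i) l P Q R s t s' t'"
  obtains a b where "n ^ (j - i) dvd a - l * b" "a\<^sup>2 + D * b\<^sup>2 = n ^ (j - i)"
proof -
  note he = e[unfolded lattice_basis_def] and hf = f[unfolded lattice_basis_def]
  have P: "P > 0" using he by blast
  have "coprime (n ^ j) (2 * D)" using assms(2) by simp
  then obtain x y z where xyz: "x * P + y * (2 * Q) + z * R = 1"
    using lattice_basis_primitive[OF e] by blast
  obtain a1 b1 where 1: "u * s + D * v * t = n ^ i * a1" "v * s - u * t = n ^ i * b1"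
    "n ^ (j - i) dvd a1 - l * b1"
    using lattice_conj_product[OF assms(4,3), of u v s t] he hf assms(1) by auto
  obtain a2 b2 where 2: "u' * s + D * v' * t = n ^ i * a2" "v' * s - u' * t = n ^ i * b2"
    "n ^ (j - i) dvd a2 - l * b2"
    using lattice_conj_product[OF assms(4,3), of u' v' s t] he hf assms(1) by auto
  obtain a3 b3 where 3: "u * s' + D * v * t' = n ^ i * a3" "v * s' - u * t' = n ^ i * b3"
    "n ^ (j - i) dvd a3 - l * b3"
    using lattice_conj_product[OF assms(4,3), of u v s' t'] he hf assms(1) by auto
  obtain a4 b4 where 4: "u' * s' + D * v' * t' = n ^ i * a4" "v' * s' - u' * t' = n ^ i * b4"
    "n ^ (j - i) dvd a4 - l * b4"
    using lattice_conj_product[OF assms(4,3), of u' v' s' t'] he hf assms(1) by auto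
  \<comment> \<open>\<open>(a, b)\<close> is the quotient of the first basis elements of the two lattices: multiplied by \<open>P\<close>,
    \<open>2 Q\<close> and \<open>R\<close> it is integral, and these three numbers are coprime.\<close>
  define a where "a = x * a1 + y * (a2 + a3) + z * a4"
  define b where "b = x * b1 + y * (b2 + b3) + z * b4"
  have "a - l * b = x * (a1 - l * b1) + y * ((a2 - l * b2) + (a3 - l * b3)) + z * (a4 - l * b4)"
    unfolding a_def b_def by (simp add: algebra_simps)
  then have dv: "n ^ (j - i) dvd a - l * b" using 1 2 3 4 by simp
  have eu: "P * u' = Q * u - D * v" and ev: "P * v' = Q * v + u" and en: "u\<^sup>2 + D * v\<^sup>2 = P * n ^ j"
    and PR: "P * R = Q\<^sup>2 + D" using he by auto
  have fu: "P * s' = Q * s - D * t" and fv: "P * t' = Q * t + s" and fn: "s\<^sup>2 + D * t\<^sup>2 = P * n ^ i"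
    using hf by auto
  \<comment> \<open>In both lattices the second basis element is the first one times
    \<open>(Q + sqrt (- D)) / P\<close>, of norm \<open>R / P\<close> and trace
    \<open>2 Q / P\<close>. Hence the fourth product is \<open>R / P\<close> times the first, and
    the two mixed products add up to \<open>2 Q / P\<close> times it.\<close>
  have "P * (P * (n ^ i * a4)) = P * (R * (n ^ i * a1))"
  proof -
    have "P * (P * (u' * s' + D * v' * t')) = (P * u') * (P * s') + D * (P * v') * (P * t')"
      by (simp add: algebra_simps)
    also have "\<dots> = (P * R) * (u * s + D * v * t)"
      unfolding eu ev fu fv PR by (simp add: algebra_simps power2_eq_square)
    finally show ?thesis unfolding 1(1)[symmetric] 4(1)[symmetric] by (simp add: mult_ac)
  qed
  then have a4: "P * a4 = R * a1" using P assms(1) by simp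
  have "P * (P * (n ^ i * b4)) = P * (R * (n ^ i * b1))"
  proof -
    have "P * (P * (v' * s' - u' * t')) = (P * v') * (P * s') - (P * u') * (P * t')"
      by (simp add: algebra_simps)
    also have "\<dots> = (P * R) * (v * s - u * t)"
      unfolding eu ev fu fv PR by (simp add: algebra_simps power2_eq_square)
    finally show ?thesis unfolding 1(2)[symmetric] 4(2)[symmetric] by (simp add: mult_ac)
  qed
  then have b4: "P * b4 = R * b1" using P assms(1) by simp
  have "n ^ i * (P * (a2 + a3)) = n ^ i * (2 * Q * a1)"
  proof -
    have "n ^ i * (P * (a2 + a3)) = (P * u') * s + D * (P * v') * t + u * (P * s') + D * v * (P * t')"
    proof -
      have "n ^ i * (P * (a2 + a3)) = P * (n ^ i * a2) + P * (n ^ i * a3)" by (simp add: algebra_simps)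
      then show ?thesis unfolding 2(1)[symmetric] 3(1)[symmetric] by (simp add: algebra_simps)
    qed
    also have "\<dots> = 2 * Q * (u * s + D * v * t)"
      unfolding eu ev fu fv by (simp add: algebra_simps)
    finally show ?thesis unfolding 1(1) by (simp only: mult_ac)
  qed
  then have a23: "P * (a2 + a3) = 2 * Q * a1" using assms(1) by simp
  have "n ^ i * (P * (b2 + b3)) = n ^ i * (2 * Q * b1)"
  proof -
    have "n ^ i * (P * (b2 + b3)) = (P * v') * s - (P * u') * t + v * (P * s') - u * (P * t')"
    proof -
      have "n ^ i * (P * (b2 + b3)) = P * (n ^ i * b2) + P * (n ^ i * b3)" by (simp add: algebra_simps)
      then show ?thesis unfolding 2(2)[symmetric] 3(2)[symmetric] by (simp add: algebra_simps)
    qed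
    also have "\<dots> = 2 * Q * (v * s - u * t)"
      unfolding eu ev fu fv by (simp add: algebra_simps)
    finally show ?thesis unfolding 1(2) by (simp only: mult_ac)
  qed
  then have b23: "P * (b2 + b3) = 2 * Q * b1" using assms(1) by simp
  have Pa: "P * a = a1"
  proof -
    have "P * a = x * P * a1 + y * (P * (a2 + a3)) + z * (P * a4)"
      unfolding a_def by (simp add: algebra_simps)
    also have "\<dots> = (x * P + y * (2 * Q) + z * R) * a1"
      unfolding a23 a4 by (simp add: algebra_simps)
    finally show ?thesis unfolding xyz by simp
  qed
  have Pb: "P * b = b1"
  proof -
    have "P * b = x * P * b1 + y * (P * (b2 + b3)) + z * (P * b4)"
      unfolding b_def by (simp add: algebra_simps)
    also have "\<dots> = (x * P + y * (2 * Q) + z * R) * b1"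
      unfolding b23 b4 by (simp add: algebra_simps)
    finally show ?thesis unfolding xyz by simp
  qed
  have nj: "n ^ j = n ^ i * n ^ (j - i)" using assms(3) by (simp flip: power_add)
  have "(P * n ^ i)\<^sup>2 * (a\<^sup>2 + D * b\<^sup>2) = (n ^ i * (P * a))\<^sup>2 + D * (n ^ i * (P * b))\<^sup>2" by (simp add: algebra_simps power2_eq_square)
  also have "\<dots> = (u * s + D * v * t)\<^sup>2 + D * (v * s - u * t)\<^sup>2" unfolding Pa Pb using 1 by simp
  also have "\<dots> = (P * n ^ j) * (P * n ^ i)" unfolding norm_mult_identity en fn ..
  also have "\<dots> = (P * n ^ i)\<^sup>2 * n ^ (j - i)" unfolding nj by (simp add: algebra_simps power2_eq_square)
  finally have "a\<^sup>2 + D * b\<^sup>2 = n ^ (j - i)" using P assms(1) by simp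
  with dv show ?thesis using that by blast
qed

section \<open>Counting reduced forms, and the pigeonhole argument\<close>

text \<open>Each \<open>P\<close> leaves exactly \<open>P\<close> values of \<open>Q\<close>, so
  there are at most \<open>K * (K + 1) / 2\<close> pairs, where \<open>K\<close> is the largest
  number with \<open>3 * K * K <= 4 * D\<close>.\<close>

lemma reduced_shape_bound:
  fixes D :: int
  assumes "D \<ge> 8"
  defines "S \<equiv> {(P, Q). P > 0 \<and> - P < 2 * Q \<and> 2 * Q \<le> P \<and> 3 * P\<^sup>2 \<le> 4 * D}"
  shows "finite S" "int (card S) \<le> D - 2"
proof -
  let ?A = "{k :: nat. 3 * (int k)\<^sup>2 \<le> 4 * D}"
  define K where "K = Max ?A"
  have fin: "finite ?A"
  proof (rule finite_subset)
    show "?A \<subseteq> {..nat (4 * D)}"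
    proof safe
      fix k assume k: "3 * (int k)\<^sup>2 \<le> 4 * D"
      have "int k \<le> (int k)\<^sup>2" by (cases k) (auto simp: power2_eq_square)
      with k show "k \<le> nat (4 * D)" by linarith
    qed
  qed simp
  have "0 \<in> ?A" using assms(1) by simp
  then have K: "3 * (int K)\<^sup>2 \<le> 4 * D" unfolding K_def using Max_in[OF fin] by blast
  let ?I = "\<lambda>P :: nat. {(- int P) div 2 + 1 .. int P div 2}"
  have card: "card (?I P) = P" for P
  proof -
    have "int P div 2 - (- int P) div 2 = int P" by presburger
    then show ?thesis by simp
  qed
  have sub: "S \<subseteq> (\<lambda>(P, Q). (int P, Q)) ` (SIGMA P : {1..K}. ?I P)"
  proof safe
    fix P Q assume "(P, Q) \<in> S"
    then have h: "P > 0" "- P < 2 * Q" "2 * Q \<le> P" "3 * P\<^sup>2 \<le> 4 * D" by (auto simp: S_def)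
    then have "nat P \<in> ?A" by simp
    then have "nat P \<le> K" unfolding K_def using fin by simp
    moreover have "(- P) div 2 < Q" "Q \<le> P div 2" using h(2,3) by linarith+
    ultimately have "(nat P, Q) \<in> (SIGMA P : {1..K}. ?I P)" using h(1) by auto
    moreover have "(P, Q) = (\<lambda>(P, Q). (int P, Q)) (nat P, Q)" using h(1) by simp
    ultimately show "(P, Q) \<in> (\<lambda>(P, Q). (int P, Q)) ` (SIGMA P : {1..K}. ?I P)" by (rule image_eqI[rotated])
  qed
  have fs: "finite (SIGMA P : {1..K}. ?I P)" by simp
  show "finite S" by (rule finite_subset[OF sub]) (use fs in simp)
  have "card S \<le> card (SIGMA P : {1..K}. ?I P)" by (rule surj_card_le[OF fs sub])
  also have "\<dots> = (\<Sum>P = 1..K. P)" using card by simp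
  also have "\<dots> = K * (K + 1) div 2" by (induction K) auto
  finally have 1: "2 * int (card S) \<le> int K * (int K + 1)"
    by (metis (mono_tags, lifting) dvd_mult_div_cancel even_mult_iff even_plus_one_iff mult_le_mono2 of_nat_1 of_nat_add of_nat_le_iff of_nat_mult of_nat_numeral)
  show "int (card S) \<le> D - 2"
  proof (cases "K \<ge> 4")
    case True
    then have "0 \<le> (int K - 4) * (int K + 2)" by simp
    then have "3 * (int K)\<^sup>2 \<ge> 2 * (int K * (int K + 1)) + 8"
      by (simp add: algebra_simps power2_eq_square)
    then show ?thesis using 1 K by linarith
  next
    case False
    \<comment> \<open>At most 6 pairs remain, and \<open>D >= 8\<close> suffices.\<close>
    then have "int K * (int K + 1) \<le> 3 * 4" by (intro mult_mono) auto
    then show ?thesis using 1 assms(1) by linarith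
  qed
qed

text \<open>The \<open>D - 1\<close> levels \<open>0, ..., D - 2\<close> share at most
  \<open>D - 2\<close> pairs \<open>(P, Q)\<close>. Two levels with the same pair differ by an
  exponent \<open>m\<close> of the required kind.\<close>

lemma small_principal_power:
  fixes n l D :: int
  assumes "D \<ge> 8" "n > 0" "coprime n (2 * D)" "n ^ nat (D - 2) dvd l\<^sup>2 + D"
  obtains m a b where "1 \<le> m" "int m \<le> D - 2" "n ^ m dvd a - l * b" "a\<^sup>2 + D * b\<^sup>2 = n ^ m"
proof -
  define J where "J = nat (D - 2)"
  define S :: "(int \<times> int) set" where "S = {(P, Q). P > 0 \<and> - P < 2 * Q \<and> 2 * Q \<le> P \<and> 3 * P\<^sup>2 \<le> 4 * D}"
  have S: "finite S" "int (card S) \<le> D - 2"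
    using reduced_shape_bound[OF assms(1)] by (simp_all add: S_def)
  have dvd: "n ^ j dvd l\<^sup>2 + D" if "j \<le> J" for j
    using assms(4) le_imp_power_dvd[OF that, of n] unfolding J_def by (rule dvd_trans[rotated])
  have "\<exists>s. s \<in> S \<and> (\<exists>R u v u' v'. lattice_basis D (n ^ j) l (fst s) (snd s) R u v u' v')"
    if jJ: "j \<le> J" for j
  proof -
    obtain P Q R u v u' v' where b: "lattice_basis D (n ^ j) l P Q R u v u' v'"
      "- P < 2 * Q" "2 * Q \<le> P" "3 * P\<^sup>2 \<le> 4 * D"
    proof (rule reduced_lattice_basis[of D "n ^ j" l])
      show "D > 0" "n ^ j > 0" "n ^ j dvd l\<^sup>2 + D" using dvd[OF jJ] assms(1,2) by auto
    qed
    have "P > 0" using b(1) by (simp add: lattice_basis_def)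
    then have "(P, Q) \<in> S" using b(2-4) by (simp add: S_def)
    moreover have "\<exists>R u v u' v'. lattice_basis D (n ^ j) l (fst (P, Q)) (snd (P, Q)) R u v u' v'"
      unfolding fst_conv snd_conv by (intro exI) (rule b(1))
    ultimately show ?thesis by blast
  qed
  then have "\<forall>j\<in>{..J}. \<exists>s. s \<in> S \<and>
      (\<exists>R u v u' v'. lattice_basis D (n ^ j) l (fst s) (snd s) R u v u' v')" by simp
  from bchoice[OF this] obtain s where "\<forall>j\<in>{..J}. s j \<in> S \<and>
      (\<exists>R u v u' v'. lattice_basis D (n ^ j) l (fst (s j)) (snd (s j)) R u v u' v')" ..
  then have s: "\<And>j. j \<le> J \<Longrightarrow> s j \<in> S"
    "\<And>j. j \<le> J \<Longrightarrow> \<exists>R u v u' v'. lattice_basis D (n ^ j) l (fst (s j)) (snd (s j)) R u v u' v'"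
    by simp_all
  have "card (s ` {..J}) \<le> card S"
  proof (rule card_mono[OF S(1)])
    show "s ` {..J} \<subseteq> S" using s(1) by blast
  qed
  also have "\<dots> < card {..J}" using S(2) assms(1) unfolding J_def by simp
  finally have "\<not> inj_on s {..J}" by (rule pigeonhole)
  then obtain i j where ij: "i < j" "j \<le> J" "s i = s j"
    unfolding inj_on_def by (metis atMost_iff linorder_neqE_nat)
  obtain R u v u' v' where e: "lattice_basis D (n ^ j) l (fst (s j)) (snd (s j)) R u v u' v'"
    using s(2)[OF ij(2)] by blast
  obtain R' t w t' w' where f: "lattice_basis D (n ^ i) l (fst (s j)) (snd (s j)) R' t w t' w'"
    using s(2)[of i] ij by auto
  \<comment> \<open>The pair determines the third coefficient through
    \<open>P * R = Q * Q + D\<close>.\<close>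
  have "fst (s j) * R = fst (s j) * R'" "fst (s j) > 0" using e f by (simp_all add: lattice_basis_def)
  then have "R' = R" by simp
  obtain a b where "n ^ (j - i) dvd a - l * b" "a\<^sup>2 + D * b\<^sup>2 = n ^ (j - i)"
    using same_shape_gives_element[OF assms(2,3) less_imp_le[OF ij(1)] dvd[OF ij(2)] e f[unfolded \<open>R' = R\<close>]] by blast
  moreover have "1 \<le> j - i" "int (j - i) \<le> D - 2" using ij assms(1) unfolding J_def by auto
  ultimately show ?thesis using that by blast
qed

text \<open>Division by an element of norm \<open>n ^ m\<close>: the product with its conjugate is a
  multiple of \<open>n ^ m\<close>, because both elements belong to the same square root
  \<open>l\<close> of \<open>- D\<close>.\<close>

lemma divide_by_principal:
  fixes n l D :: int
  assumes "n > 0" "n ^ j dvd l\<^sup>2 + D" "m \<le> j"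
    and A: "n ^ j dvd B - l * A" "B\<^sup>2 + D * A\<^sup>2 = n ^ j"
    and u: "n ^ m dvd u - l * v" "u\<^sup>2 + D * v\<^sup>2 = n ^ m"
  obtains B' A' where "n ^ (j - m) dvd B' - l * A'" "B'\<^sup>2 + D * A'\<^sup>2 = n ^ (j - m)"
    "B = u * B' - D * v * A'" "A = u * A' + v * B'"
proof -
  obtain x y where xy: "B * u + D * A * v = n ^ m * x" "A * u - B * v = n ^ m * y"
    "n ^ (j - m) dvd x - l * y"
    using lattice_conj_product[OF assms(2,3) _ A(1) u(1)] assms(1) by auto
  have nj: "n ^ j = n ^ m * n ^ (j - m)" using assms(3) by (simp flip: power_add)
  have "n ^ m * (n ^ m * (x\<^sup>2 + D * y\<^sup>2)) = (n ^ m * x)\<^sup>2 + D * (n ^ m * y)\<^sup>2" by (simp add: algebra_simps power2_eq_square)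
  also have "\<dots> = n ^ j * n ^ m" unfolding xy(1,2)[symmetric] norm_mult_identity A(2) u(2) ..
  also have "\<dots> = n ^ m * (n ^ m * n ^ (j - m))" unfolding nj by simp
  finally have 1: "x\<^sup>2 + D * y\<^sup>2 = n ^ (j - m)" using assms(1) by simp
  have "n ^ m * (u * x - D * v * y) = u * (B * u + D * A * v) - D * v * (A * u - B * v)"
    unfolding xy(1,2) by (simp add: algebra_simps power2_eq_square)
  also have "\<dots> = n ^ m * B" unfolding u(2)[symmetric] by (simp add: algebra_simps power2_eq_square)
  finally have 2: "B = u * x - D * v * y" using assms(1) by simp
  have "n ^ m * (u * y + v * x) = u * (A * u - B * v) + v * (B * u + D * A * v)"
    unfolding xy(1,2) by (simp add: algebra_simps power2_eq_square)
  also have "\<dots> = n ^ m * A" unfolding u(2)[symmetric] by (simp add: algebra_simps power2_eq_square)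
  finally have "A = u * y + v * x" using assms(1) by simp
  with 1 2 xy(3) that show ?thesis by blast
qed

section \<open>Powers in imaginary quadratic orders\<close>

definition qemb :: "int \<Rightarrow> int \<Rightarrow> int \<Rightarrow> complex" where
  "qemb D u v = Complex (of_int u) (of_int v * sqrt (of_int D))"

lemma qemb_mult:
  assumes "D \<ge> 0"
  shows "qemb D u v * qemb D s t = qemb D (u * s - D * v * t) (u * t + v * s)"
proof -
  define w where "w = sqrt (of_int D)"
  have "w * w = of_int D" using assms by (simp add: w_def)
  then have "(of_int v * w) * (of_int t * w) = of_int D * of_int v * of_int t"
    by (simp add: mult.assoc mult.left_commute)
  then show ?thesis
    unfolding qemb_def w_def[symmetric] by (auto simp: complex_eq_iff algebra_simps)
qed

lemma qemb_eq_iff: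
  assumes "D > 0"
  shows "qemb D u v = qemb D s t \<longleftrightarrow> u = s \<and> v = t"
  using assms by (auto simp: qemb_def)

lemma qemb_uminus: "- qemb D u v = qemb D (- u) (- v)"
  by (simp add: qemb_def complex_eq_iff)

lemma qemb_power:
  assumes "D \<ge> 0"
  obtains a b where "qemb D u v ^ k = qemb D a b" "a\<^sup>2 + D * b\<^sup>2 = (u\<^sup>2 + D * v\<^sup>2) ^ k"
proof -
  have "\<exists>a b. qemb D u v ^ k = qemb D a b \<and> a\<^sup>2 + D * b\<^sup>2 = (u\<^sup>2 + D * v\<^sup>2) ^ k"
  proof (induction k)
    case 0
    show ?case by (intro exI[of _ 1] exI[of _ 0]) (simp add: qemb_def complex_eq_iff)
  next
    case (Suc k)
    then obtain a b where ab: "qemb D u v ^ k = qemb D a b" "a\<^sup>2 + D * b\<^sup>2 = (u\<^sup>2 + D * v\<^sup>2) ^ k"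
      by blast
    have "(u * a - D * v * b)\<^sup>2 + D * (u * b + v * a)\<^sup>2 = (u\<^sup>2 + D * v\<^sup>2) * (a\<^sup>2 + D * b\<^sup>2)"
      by (simp add: algebra_simps power2_eq_square)
    moreover have "qemb D u v ^ Suc k = qemb D (u * a - D * v * b) (u * b + v * a)"
      using ab(1) qemb_mult[OF assms, of u v a b] by simp
    ultimately show ?case using ab(2) by (metis power_Suc)
  qed
  then show ?thesis using that by blast
qed

lemma extract_power:
  fixes n l D :: int
  assumes "D \<ge> 0" "n > 0" "n ^ j dvd l\<^sup>2 + D"
    and "n ^ m dvd u - l * v" "u\<^sup>2 + D * v\<^sup>2 = n ^ m"
    and "n ^ j dvd B - l * A" "B\<^sup>2 + D * A\<^sup>2 = n ^ j" "m * t \<le> j"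
  obtains B' A' where "n ^ (j - m * t) dvd B' - l * A'" "B'\<^sup>2 + D * A'\<^sup>2 = n ^ (j - m * t)"
    "qemb D B A = qemb D u v ^ t * qemb D B' A'"
proof -
  have "\<exists>B' A'. n ^ (j - m * t) dvd B' - l * A' \<and> B'\<^sup>2 + D * A'\<^sup>2 = n ^ (j - m * t) \<and>
    qemb D B A = qemb D u v ^ t * qemb D B' A'" using assms(8)
  proof (induction t)
    case 0
    show ?case using assms(6,7) by auto
  next
    case (Suc t)
    then obtain B' A' where h: "n ^ (j - m * t) dvd B' - l * A'" "B'\<^sup>2 + D * A'\<^sup>2 = n ^ (j - m * t)"
      "qemb D B A = qemb D u v ^ t * qemb D B' A'" by auto
    have d: "n ^ (j - m * t) dvd l\<^sup>2 + D"
      using assms(3) le_imp_power_dvd[of "j - m * t" j n] by (meson diff_le_self dvd_trans)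
    have m: "m \<le> j - m * t" "j - m * t - m = j - m * Suc t" using Suc.prems by auto
    obtain B'' A'' where k: "n ^ (j - m * Suc t) dvd B'' - l * A''" "B''\<^sup>2 + D * A''\<^sup>2 = n ^ (j - m * Suc t)"
      "B' = u * B'' - D * v * A''" "A' = u * A'' + v * B''"
      using divide_by_principal[OF assms(2) d m(1) h(1,2) assms(4,5)] unfolding m(2) by blast
    have "qemb D B' A' = qemb D u v * qemb D B'' A''"
      unfolding k(3,4) qemb_mult[OF assms(1)] by simp
    with h(3) k(1,2) show ?case by (metis mult.assoc power_Suc2)
  qed
  then show ?thesis using that by blast
qed

section \<open>Elements of norm \<open>n ^ z\<close> as powers\<close>

text \<open>The root \<open>l\<close> is the quotient of \<open>B\<close> by \<open>A\<close> modulo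
  \<open>n ^ z\<close>; it determines the lattice that contains \<open>(B, A)\<close>.\<close>

lemma square_root_mod_power:
  fixes n D A B :: int
  assumes "coprime A n" "n ^ z dvd B\<^sup>2 + D * A\<^sup>2"
  obtains l where "n ^ z dvd l\<^sup>2 + D" "n ^ z dvd B - l * A"
proof -
  have c: "coprime A (n ^ z)" using assms(1) by simp
  obtain i where i: "[A * i = 1] (mod n ^ z)" using cong_solve_coprime_int[OF c] by blast
  obtain k where k: "A * i = 1 + n ^ z * k"
    using i by (metis cong_iff_lin cong_sym mult.commute)
  define l where "l = B * i"
  have 1: "n ^ z dvd B - l * A"
  proof -
    have "B - l * A = B * (1 - A * i)" unfolding l_def by (simp add: algebra_simps)
    also have "\<dots> = n ^ z * (- B * k)" unfolding k by simp
    finally have "B - l * A = n ^ z * (- B * k)" .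
    then show ?thesis by simp
  qed
  have "A\<^sup>2 * (l\<^sup>2 + D) = (B\<^sup>2 + D * A\<^sup>2) - (B - l * A) * (B + l * A)"
    by (simp add: algebra_simps power2_eq_square)
  also have "n ^ z dvd \<dots>" using assms(2) 1 by simp
  finally have "n ^ z dvd l\<^sup>2 + D" using c
    by (metis coprime_commute coprime_dvd_mult_right_iff coprime_power_right_iff zero_less_numeral)
  with 1 that show ?thesis by blast
qed

text \<open>The least \<open>m > 0\<close> such that level \<open>n ^ m\<close> contains an element
  of norm \<open>n ^ m\<close> plays the role of the order of an ideal class. It divides
  \<open>z\<close>, and \<open>m <= D - 2 < z\<close> leaves a prime \<open>q\<close> dividing
  \<open>z / m\<close>.\<close>

lemma odd_prime_power_root:
  fixes n D A B :: int
  assumes "D \<ge> 8" "n > 0" "coprime n (2 * D)" "coprime A n" "B\<^sup>2 + D * A\<^sup>2 = n ^ z"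
    "D - 1 \<le> int z" "odd z"
  obtains q M X Y where "prime q" "odd q" "z = M * q" "X\<^sup>2 + D * Y\<^sup>2 = n ^ M"
    "qemb D B A = qemb D X Y ^ q \<or> qemb D B A = - (qemb D X Y ^ q)"
proof -
  obtain l where l: "n ^ z dvd l\<^sup>2 + D" "n ^ z dvd B - l * A"
    using square_root_mod_power[OF assms(4), of z B D] assms(5) by auto
  let ?T = "\<lambda>m. 1 \<le> m \<and> (\<exists>a b. n ^ m dvd a - l * b \<and> a\<^sup>2 + D * b\<^sup>2 = n ^ m)"
  have "nat (D - 2) \<le> z" using assms(6) by simp
  then have "n ^ nat (D - 2) dvd l\<^sup>2 + D" using l(1) le_imp_power_dvd dvd_trans by blast
  then obtain m0 where m0: "?T m0" "int m0 \<le> D - 2"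
    using small_principal_power[OF assms(1-3)] by metis
  define m where "m = (LEAST m. ?T m)"
  have "?T m" unfolding m_def using m0(1) by (rule LeastI)
  then obtain u v where m: "1 \<le> m" "n ^ m dvd u - l * v" "u\<^sup>2 + D * v\<^sup>2 = n ^ m" by blast
  have "m \<le> m0" unfolding m_def using m0(1) by (rule Least_le)
  then have mz: "m < z" using m0(2) assms(6) by linarith
  define t where "t = z div m"
  have r: "z - m * t = z mod m" by (simp add: t_def minus_mult_div_eq_mod)
  have D: "D \<ge> 0" using assms(1) by simp
  have le: "m * t \<le> z" by (simp add: t_def)
  obtain B' A' where B': "n ^ (z mod m) dvd B' - l * A'" "B'\<^sup>2 + D * A'\<^sup>2 = n ^ (z mod m)"
    "qemb D B A = qemb D u v ^ t * qemb D B' A'"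
    using extract_power[OF D assms(2) l(1) m(2,3) l(2) assms(5) le] unfolding r by blast
  have "z mod m = 0"
  proof (rule ccontr)
    assume "z mod m \<noteq> 0"
    then have "?T (z mod m)" using B' by auto
    then have "m \<le> z mod m" unfolding m_def by (rule Least_le)
    moreover have "z mod m < m" using m(1) by simp
    ultimately show False by simp
  qed
  then have zt: "z = m * t" using r le by simp
  \<comment> \<open>After \<open>t\<close> divisions a unit is left, which is 1 or -1 because
    \<open>D > 1\<close>.\<close>
  have unit: "B'\<^sup>2 + D * A'\<^sup>2 = 1" using B'(2) \<open>z mod m = 0\<close> by simp
  have "A' = 0"
  proof (rule ccontr)
    assume "A' \<noteq> 0"
    then have "A'\<^sup>2 \<ge> 1" by (simp add: int_one_le_iff_zero_less)
    then have "D * A'\<^sup>2 \<ge> D * 1" using D by (intro mult_left_mono) auto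
    then show False using unit assms(1) zero_le_power2[of B'] by linarith
  qed
  with unit have "B' = 1 \<or> B' = - 1" by (simp add: power2_eq_1_iff)
  then have "qemb D B' A' = 1 \<or> qemb D B' A' = - 1"
    using \<open>A' = 0\<close> by (auto simp: qemb_def complex_eq_iff)
  then have pm: "qemb D B A = qemb D u v ^ t \<or> qemb D B A = - (qemb D u v ^ t)"
    using B'(3) by auto
  have "t \<noteq> 1" using zt mz by auto
  then obtain q where q: "prime q" "q dvd t" using prime_factor_nat by blast
  then obtain c where c: "t = q * c" by auto
  have "odd q" using assms(7) zt c by simp
  obtain X Y where XY: "qemb D u v ^ c = qemb D X Y" "X\<^sup>2 + D * Y\<^sup>2 = (u\<^sup>2 + D * v\<^sup>2) ^ c"
    using qemb_power[OF D] by blast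
  have "qemb D u v ^ t = qemb D X Y ^ q" unfolding c XY(1)[symmetric] by (simp add: mult.commute flip: power_mult)
  moreover have "X\<^sup>2 + D * Y\<^sup>2 = n ^ (m * c)" unfolding XY(2) m(3) by (simp add: power_mult)
  moreover have "z = m * c * q" using zt c by simp
  ultimately show ?thesis using that q(1) \<open>odd q\<close> pm by metis
qed

text \<open>For \<open>D = 1\<close> reduction forces \<open>P = 1\<close>, that is, class number
  one. So level \<open>n\<close> already contains an element of norm \<open>n\<close>, and dividing
  by it \<open>z\<close> times leaves a unit.\<close>

lemma gaussian_power_root:
  fixes n A B :: int
  assumes "n > 0" "coprime A n" "B\<^sup>2 + A\<^sup>2 = n ^ z" "z > 0"
  obtains u v a b where "u\<^sup>2 + v\<^sup>2 = n" "a\<^sup>2 + b\<^sup>2 = 1" "qemb 1 B A = qemb 1 u v ^ z * qemb 1 a b"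
proof -
  obtain l where l: "n ^ z dvd l\<^sup>2 + 1" "n ^ z dvd B - l * A"
    using square_root_mod_power[OF assms(2), of z B 1] assms(3) by auto
  have "n dvd l\<^sup>2 + 1" using l(1) assms(4) by (meson dvd_power dvd_trans)
  then obtain P Q R u v u' v' where b: "lattice_basis 1 n l P Q R u v u' v'" "3 * P\<^sup>2 \<le> 4 * (1::int)"
    using reduced_lattice_basis[of 1 n l] assms(1) by (metis zero_less_one)
  have "P > 0" using b(1) by (simp add: lattice_basis_def)
  have "P = 1"
  proof (rule ccontr)
    assume "P \<noteq> 1"
    then have "2 * 2 \<le> P * P" using \<open>P > 0\<close> by (intro mult_mono) auto
    then show False using b(2) by (simp add: power2_eq_square)
  qed
  then have u: "n ^ 1 dvd u - l * v" "u\<^sup>2 + 1 * v\<^sup>2 = n ^ 1" using b(1) by (auto simp: lattice_basis_def)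
  obtain B' A' where "B'\<^sup>2 + 1 * A'\<^sup>2 = n ^ (z - 1 * z)" "qemb 1 B A = qemb 1 u v ^ z * qemb 1 B' A'"
    using extract_power[OF _ assms(1) l(1) u l(2), of z] assms(3) by auto
  then show ?thesis using that u(2) by simp
qed

section \<open>Lucas numbers of odd index\<close>

text \<open>For \<open>U = x\<^sup>2\<close> and \<open>V = y\<^sup>2\<close>, these are the cofactors of \<open>y\<close> and \<open>x\<close> in \<open>(x + y) ^ (2 h + 1)\<close>;
  \<open>odd_part h (X\<^sup>2) (- (D * Y\<^sup>2))\<close> is the Lucas number of index \<open>2 h + 1\<close> of
  \<open>X + Y sqrt (- D)\<close>.\<close>
definition odd_part :: "nat \<Rightarrow> 'a \<Rightarrow> 'a \<Rightarrow> 'a :: comm_ring_1" where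
  "odd_part h U V = (\<Sum>r\<le>h. of_nat ((2 * h + 1) choose (2 * r + 1)) * U ^ (h - r) * V ^ r)"

definition even_part :: "nat \<Rightarrow> 'a \<Rightarrow> 'a \<Rightarrow> 'a :: comm_ring_1" where
  "even_part h U V = (\<Sum>r\<le>h. of_nat ((2 * h + 1) choose (2 * r)) * U ^ (h - r) * V ^ r)"

lemma sum_even_odd_indices:
  fixes f :: "nat \<Rightarrow> 'a :: comm_monoid_add"
  shows "(\<Sum>i\<le>2 * h + 1. f i) = (\<Sum>r\<le>h. f (2 * r)) + (\<Sum>r\<le>h. f (2 * r + 1))"
  by (induction h) (simp_all add: ac_simps)

lemma power_odd_expansion:
  fixes x y :: "'a :: comm_ring_1"
  shows "(x + y) ^ (2 * h + 1) = x * even_part h (x\<^sup>2) (y\<^sup>2) + y * odd_part h (x\<^sup>2) (y\<^sup>2)"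
proof -
  let ?f = "\<lambda>k. of_nat ((2 * h + 1) choose k) * y ^ k * x ^ (2 * h + 1 - k)"
  have "(x + y) ^ (2 * h + 1) = (\<Sum>k\<le>2 * h + 1. ?f k)"
    unfolding add.commute[of x y] by (rule binomial_ring)
  also have "\<dots> = (\<Sum>r\<le>h. ?f (2 * r)) + (\<Sum>r\<le>h. ?f (2 * r + 1))"
    by (rule sum_even_odd_indices)
  also have "(\<Sum>r\<le>h. ?f (2 * r)) = x * even_part h (x\<^sup>2) (y\<^sup>2)"
    unfolding even_part_def sum_distrib_left
  proof (rule sum.cong)
    fix r assume "r \<in> {..h}"
    then have "2 * h + 1 - 2 * r = Suc (2 * (h - r))" by auto
    then show "?f (2 * r) = x * (of_nat ((2 * h + 1) choose (2 * r)) * (x\<^sup>2) ^ (h - r) * (y\<^sup>2) ^ r)"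
      by (simp add: mult_ac flip: power_mult)
  qed simp
  also have "(\<Sum>r\<le>h. ?f (2 * r + 1)) = y * odd_part h (x\<^sup>2) (y\<^sup>2)"
    unfolding odd_part_def sum_distrib_left
  proof (rule sum.cong)
    fix r assume "r \<in> {..h}"
    then have "2 * h + 1 - (2 * r + 1) = 2 * (h - r)" by auto
    then show "?f (2 * r + 1) = y * (of_nat ((2 * h + 1) choose (2 * r + 1)) * (x\<^sup>2) ^ (h - r) * (y\<^sup>2) ^ r)"
      by (simp add: mult_ac flip: power_mult)
  qed simp
  finally show ?thesis .
qed

lemma of_int_odd_part: "of_int (odd_part h U V) = odd_part h (of_int U) (of_int V)"
  by (simp add: odd_part_def)

lemma of_int_even_part: "of_int (even_part h U V) = even_part h (of_int U) (of_int V)"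
  by (simp add: even_part_def)

lemma qemb_power_odd:
  assumes "D \<ge> 0"
  shows "qemb D X Y ^ (2 * h + 1) =
    qemb D (X * even_part h (X\<^sup>2) (- (D * Y\<^sup>2))) (Y * odd_part h (X\<^sup>2) (- (D * Y\<^sup>2)))"
proof -
  define w where "w = Complex 0 (sqrt (of_int D))"
  have e: "qemb D a b = of_int a + of_int b * w" for a b
    by (simp add: qemb_def w_def complex_eq_iff)
  have w: "w\<^sup>2 = - of_int D" using assms
    by (simp add: w_def complex_eq_iff power2_eq_square)
  have 1: "(of_int X :: complex)\<^sup>2 = of_int (X\<^sup>2)" by simp
  have 2: "(of_int Y * w)\<^sup>2 = of_int (- (D * Y\<^sup>2))" by (simp add: power_mult_distrib w)
  show ?thesis unfolding e power_odd_expansion 1 2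
    by (simp add: of_int_odd_part of_int_even_part mult_ac)
qed

section \<open>Congruences for Lucas numbers\<close>

lemma odd_part_cong:
  fixes U V U' V' :: int
  assumes "[U = U'] (mod m)" "[V = V'] (mod m)"
  shows "[odd_part h U V = odd_part h U' V'] (mod m)"
  unfolding odd_part_def by (intro cong_sum cong_mult cong_pow assms cong_refl)

lemma odd_part_split:
  fixes U V :: int
  shows "odd_part h U V = int (2 * h + 1) * U ^ h +
    (\<Sum>r=1..h. int ((2 * h + 1) choose (2 * r + 1)) * U ^ (h - r) * V ^ r)"
proof -
  have "{..h} = insert 0 {1..h}" by auto
  then show ?thesis by (simp add: odd_part_def)
qed

text \<open>The term \<open>r = 0\<close> is the only one without a factor \<open>V\<close>; the
  valuation arguments compare the whole sum with it.\<close>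

lemma odd_part_minus_head_dvd:
  fixes U V :: int
  assumes "\<And>r. 1 \<le> r \<Longrightarrow> r \<le> h \<Longrightarrow> m dvd int ((2 * h + 1) choose (2 * r + 1)) * V ^ r"
  shows "m dvd odd_part h U V - int (2 * h + 1) * U ^ h"
proof -
  have "m dvd (\<Sum>r=1..h. int ((2 * h + 1) choose (2 * r + 1)) * U ^ (h - r) * V ^ r)"
  proof (rule dvd_sum)
    fix r assume "r \<in> {1..h}"
    then have "1 \<le> r" "r \<le> h" by auto
    then have "m dvd int ((2 * h + 1) choose (2 * r + 1)) * V ^ r * U ^ (h - r)"
      by (rule dvd_mult2[OF assms])
    then show "m dvd int ((2 * h + 1) choose (2 * r + 1)) * U ^ (h - r) * V ^ r"
      by (simp only: mult_ac)
  qed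
  then show ?thesis unfolding odd_part_split by simp
qed

text \<open>Half the difference of \<open>(1 + 1) ^ (2 h + 1)\<close> and
  \<open>(1 - 1) ^ (2 h + 1)\<close>.\<close>

lemma odd_part_ones: "odd_part h 1 (1 :: int) = 4 ^ h"
proof -
  have "(1 + 1 :: int) ^ (2 * h + 1) = even_part h 1 1 + odd_part h 1 1"
    using power_odd_expansion[of "1 :: int" 1 h] by simp
  moreover have "(1 + - 1 :: int) ^ (2 * h + 1) = even_part h 1 1 - odd_part h 1 1"
    using power_odd_expansion[of "1 :: int" "- 1" h] by simp
  ultimately show ?thesis by (simp add: power_mult)
qed

text \<open>The number is the imaginary part of \<open>(1 + i) ^ (2 h + 1)\<close>. Since
  \<open>(1 + i) ^ 8 = 16\<close> and \<open>(1 + i) ^ 7 = 8 - 8 i\<close>, it equals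
  \<open>- 8 * 16 ^ k\<close>.\<close>

lemma odd_part_one_minus_one:
  assumes "(2 * h + 1) mod 8 = 7"
  shows "[odd_part h 1 (- 1 :: int) = 1] (mod 3)"
proof -
  define k where "k = (2 * h + 1) div 8"
  have k: "2 * h + 1 = 8 * k + 7" using assms unfolding k_def by presburger
  have 2: "qemb 1 1 1 ^ 2 = qemb 1 0 2" by (simp add: power2_eq_square qemb_mult)
  have 4: "qemb 1 1 1 ^ 4 = qemb 1 (- 4) 0"
    using power_add[of "qemb 1 1 1" 2 2] unfolding 2 by (simp add: qemb_mult)
  have 3: "qemb 1 1 1 ^ 3 = qemb 1 (- 2) 2"
    using power_add[of "qemb 1 1 1" 2 1] unfolding 2 by (simp add: qemb_mult)
  have "qemb 1 1 1 ^ 8 = qemb 1 16 0"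
    using power_add[of "qemb 1 1 1" 4 4] unfolding 4 by (simp add: qemb_mult)
  moreover have "qemb 1 1 1 ^ 7 = qemb 1 8 (- 8)"
    using power_add[of "qemb 1 1 1" 4 3] unfolding 3 4 by (simp add: qemb_mult)
  ultimately
  have "qemb 1 1 1 ^ (2 * h + 1) = 16 ^ k * qemb 1 8 (- 8)"
    unfolding k power_add power_mult by (simp add: qemb_def complex_eq_iff)
  also have "\<dots> = qemb 1 (16 ^ k * 8) (16 ^ k * (- 8))"
  proof -
    have "(16 ^ k :: complex) = qemb 1 (16 ^ k) 0" by (simp add: qemb_def complex_eq_iff)
    then show ?thesis by (simp add: qemb_mult)
  qed
  finally have "odd_part h 1 (- 1 :: int) = 16 ^ k * (- 8)"
    using qemb_power_odd[of 1 1 1 h] by (simp add: qemb_eq_iff)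
  moreover have "[16 ^ k * (- 8) = 1 ^ k * (1 :: int)] (mod 3)"
    by (intro cong_mult cong_pow) (auto simp: cong_def)
  ultimately show ?thesis by simp
qed

section \<open>Prime valuations of the terms of a Lucas number\<close>

text \<open>Two absorption steps expose the factor \<open>2 h\<close>, whose \<open>p\<close>-part
  is lost only to the denominator \<open>2 r (2 r + 1)\<close>.\<close>

lemma binomial_odd_absorb:
  assumes "1 \<le> r"
  shows "((2 * h + 1) choose (2 * r + 1)) * (2 * r * (2 * r + 1)) =
    2 * h * (2 * h + 1) * ((2 * h - 1) choose (2 * r - 1))"
proof (cases "h = 0")
  case True
  then show ?thesis using assms by simp
next
  case False
  have "(2 * r + 1) * ((2 * h + 1) choose (2 * r + 1)) = (2 * h + 1) * ((2 * h) choose (2 * r))"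
    using Suc_times_binomial[of "2 * r" "2 * h"] by simp
  then have "((2 * h + 1) choose (2 * r + 1)) * (2 * r * (2 * r + 1)) =
      (2 * h + 1) * (2 * r * ((2 * h) choose (2 * r)))"
    by (metis mult.assoc mult.commute)
  also have "2 * r * ((2 * h) choose (2 * r)) = 2 * h * ((2 * h - 1) choose (2 * r - 1))"
    using times_binomial_minus1_eq[of "2 * r" "2 * h"] assms by simp
  finally show ?thesis by (simp only: mult_ac)
qed

text \<open>The primes \<open>p\<close> and multiples \<open>d\<close> of \<open>p\<close> for which a power \<open>d ^ r\<close> with \<open>r > 0\<close> outweighs the
  \<open>p\<close>-part of the denominator \<open>2 r (2 r + 1)\<close> in the absorption identity above.\<close>
definition admissible :: "nat \<Rightarrow> nat \<Rightarrow> bool" where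
  "admissible p d \<longleftrightarrow> p = 2 \<and> d = 4 \<or> prime p \<and> p \<ge> 5 \<and> d = p"

lemma admissible_prime: "admissible p d \<Longrightarrow> prime p"
  by (auto simp: admissible_def)

text \<open>With base 3 this fails at \<open>r = 1\<close>, whence \<open>p >= 5\<close> in
  \<open>admissible\<close>.\<close>

lemma two_mul_add_one_less_power_five: "1 \<le> r \<Longrightarrow> 2 * r + 1 < (5 :: nat) ^ r"
  by (induction r rule: dec_induct) auto

text \<open>Since \<open>2 r\<close> and \<open>2 r + 1\<close> are coprime, \<open>p ^ v\<close>
  divides one of them. So \<open>2 ^ v <= 2 r < 2 ^ (2 r)\<close> for \<open>p = 2\<close>, and
  \<open>p ^ v <= 2 r + 1 < 5 ^ r <= p ^ r\<close> otherwise.\<close>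

lemma admissible_power_dvd:
  assumes "admissible p d" "1 \<le> r" "p ^ v dvd 2 * r * (2 * r + 1)"
  shows "p ^ (v + 1) dvd d ^ r"
proof (cases "p = 2")
  case True
  then have d: "d = 2 ^ 2" using assms(1) by (auto simp: admissible_def)
  have "coprime (2 ^ v) (2 * r + 1 :: nat)" by simp
  then have "2 ^ v dvd 2 * r" using assms(3) unfolding True by (simp only: coprime_dvd_mult_left_iff)
  then have "2 ^ v \<le> 2 * r" using assms(2) by (intro dvd_imp_le) auto
  also have "\<dots> < 2 ^ (2 * r)" by (rule less_exp)
  finally have "v < 2 * r" by simp
  then show ?thesis unfolding True d power_mult[symmetric] by (intro le_imp_power_dvd) simp
next
  case False
  then have p: "prime p" "p \<ge> 5" "d = p" using assms(1) by (auto simp: admissible_def)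
  have "coprime (2 * r) (2 * r + 1)" by simp
  then have "p ^ v dvd 2 * r \<or> p ^ v dvd 2 * r + 1"
  proof (cases "p dvd 2 * r")
    case True
    then have "\<not> p dvd 2 * r + 1" using p(1) \<open>coprime (2 * r) (2 * r + 1)\<close>
      by (meson coprime_common_divisor not_prime_unit)
    then have "coprime (p ^ v) (2 * r + 1)" using p(1) by (simp add: prime_imp_coprime)
    then have "p ^ v dvd 2 * r" using assms(3) by (simp only: coprime_dvd_mult_left_iff)
    then show ?thesis ..
  next
    case False
    then have "coprime (p ^ v) (2 * r)" using p(1) prime_imp_coprime coprime_power_left_iff by blast
    then have "p ^ v dvd 2 * r + 1" using assms(3) by (simp only: coprime_dvd_mult_right_iff)
    then show ?thesis ..
  qed
  then have "p ^ v \<le> 2 * r + 1" using assms(2) by (auto dest!: dvd_imp_le)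
  also have "\<dots> < 5 ^ r" by (rule two_mul_add_one_less_power_five[OF assms(2)])
  also have "\<dots> \<le> p ^ r" using p(2) by (rule power_mono) simp
  finally have "v < r" using p(2) by (simp add: power_strict_increasing_iff)
  then show ?thesis unfolding p(3) by (intro le_imp_power_dvd) simp
qed

text \<open>The denominator of the absorption identity may cancel \<open>p ^ v\<close> of the factor
  \<open>2 h\<close>, but \<open>d ^ r\<close> restores it with one factor \<open>p\<close> to
  spare.\<close>

lemma binomial_term_dvd:
  assumes "admissible p d" "1 \<le> r" "p ^ k dvd 2 * h"
  shows "p ^ (k + 1) dvd ((2 * h + 1) choose (2 * r + 1)) * d ^ r"
proof -
  let ?c = "(2 * h + 1) choose (2 * r + 1)"
  have p: "prime p" by (rule admissible_prime[OF assms(1)])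
  obtain w where w: "2 * r * (2 * r + 1) = p ^ multiplicity p (2 * r * (2 * r + 1)) * w" "\<not> p dvd w"
    by (rule multiplicity_decompose'[of "2 * r * (2 * r + 1)" p]) (use assms(2) p in auto)
  define v where "v = multiplicity p (2 * r * (2 * r + 1))"
  have "p ^ k dvd ?c * (2 * r * (2 * r + 1))"
    unfolding binomial_odd_absorb[OF assms(2)] by (intro dvd_mult2 assms(3))
  then have "p ^ k dvd ?c * p ^ v * w" using w(1) by (simp add: v_def mult.assoc)
  moreover have "coprime (p ^ k) w" using w(2) p by (simp add: prime_imp_coprime)
  ultimately have 1: "p ^ k dvd ?c * p ^ v" by (simp add: coprime_dvd_mult_left_iff)
  have "p ^ (v + 1) dvd d ^ r"
    by (rule admissible_power_dvd[OF assms(1,2)]) (simp add: v_def multiplicity_dvd)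
  with 1 have "p ^ k * p ^ (v + 1) dvd (?c * p ^ v) * d ^ r" by (rule mult_dvd_mono)
  then have "p ^ v * p ^ (k + 1) dvd p ^ v * (?c * d ^ r)" by (simp add: mult_ac)
  then show ?thesis using p by (simp add: dvd_mult_cancel_left prime_gt_0_nat)
qed

text \<open>Lifting the exponent: each \<open>p\<close>-th power gains a factor \<open>p\<close>,
  since the cofactor of \<open>V - 1\<close> in \<open>V ^ p - 1\<close> is a sum of
  \<open>p\<close> terms congruent to 1 modulo \<open>p\<close>.\<close>

lemma power_minus_one_dvd:
  fixes U :: int and p :: nat
  assumes "int p ^ e dvd U - 1" "1 \<le> e"
  shows "int p ^ (k + e) dvd U ^ (p ^ k * m) - 1"
proof -
  have "int p ^ (k + e) dvd U ^ (p ^ k) - 1"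
  proof (induction k)
    case 0
    then show ?case using assms(1) by simp
  next
    case (Suc k)
    define V where "V = U ^ (p ^ k)"
    have IH: "int p ^ (k + e) dvd V - 1" using Suc by (simp add: V_def)
    have "int p dvd V - 1"
      by (rule dvd_trans[OF _ IH]) (use assms(2) in \<open>auto intro: dvd_power\<close>)
    then have "[V = 1] (mod int p)" by (simp add: cong_iff_dvd_diff)
    then have "[(\<Sum>i<p. V ^ i) = (\<Sum>i<p. 1 ^ i)] (mod int p)" by (intro cong_sum cong_pow)
    then have "int p dvd (\<Sum>i<p. V ^ i)" by (simp add: cong_dvd_iff)
    with IH have "int p ^ (k + e) * int p dvd (V - 1) * (\<Sum>i<p. V ^ i)" by (rule mult_dvd_mono)
    also have "\<dots> = V ^ p - 1" by (rule power_diff_1_eq[symmetric])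
    also have "\<dots> = U ^ (p ^ Suc k) - 1"
      by (simp add: V_def mult.commute flip: power_mult)
    finally show ?case by (simp add: mult.commute)
  qed
  also have "U ^ (p ^ k) - 1 dvd U ^ (p ^ k * m) - 1"
    by (simp add: power_mult power_diff_1_eq)
  finally show ?thesis .
qed

text \<open>Let \<open>p ^ k\<close> be the exact power of \<open>p\<close> in \<open>2 h\<close>.
  Modulo \<open>p ^ (k + 1)\<close> only the first term survives and \<open>U ^ h = 1\<close>, so
  the sum is \<open>2 h + 1\<close>; the value 1 would make \<open>p ^ (k + 1)\<close> divide
  \<open>2 h\<close>.\<close>

lemma odd_part_ne_one:
  fixes U E :: int
  assumes "admissible p d" "int d dvd E" "int d dvd U - 1" "h \<ge> 1"
  shows "odd_part h U (- E) \<noteq> 1"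
proof
  assume L: "odd_part h U (- E) = 1"
  have p: "prime p" by (rule admissible_prime[OF assms(1)])
  define k where "k = multiplicity p (2 * h)"
  have k: "p ^ k dvd 2 * h" "\<not> p ^ (k + 1) dvd 2 * h"
    using assms(4) p unfolding k_def
    by (simp_all add: multiplicity_dvd power_dvd_iff_le_multiplicity not_prime_unit prime_nat_iff del: power_Suc)
  have "int (p ^ (k + 1)) dvd odd_part h U (- E) - int (2 * h + 1) * U ^ h"
  proof (rule odd_part_minus_head_dvd)
    fix r assume "1 \<le> r" "r \<le> h"
    obtain e where e: "E = int d * e" using assms(2) by auto
    have "int (p ^ (k + 1)) dvd int (((2 * h + 1) choose (2 * r + 1)) * d ^ r)"
      using binomial_term_dvd[OF assms(1) \<open>1 \<le> r\<close> k(1)] by (simp only: int_dvd_int_iff)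
    then have 1: "int (p ^ (k + 1)) dvd int (((2 * h + 1) choose (2 * r + 1)) * d ^ r) * (- e) ^ r"
      by (rule dvd_mult2)
    show "int (p ^ (k + 1)) dvd int ((2 * h + 1) choose (2 * r + 1)) * (- E) ^ r"
    proof -
      have "(- E) ^ r = int d ^ r * (- e) ^ r" by (simp add: e flip: mult_minus_right power_mult_distrib)
      then have "int ((2 * h + 1) choose (2 * r + 1)) * (- E) ^ r =
          int (((2 * h + 1) choose (2 * r + 1)) * d ^ r) * (- e) ^ r"
        by (simp only: of_nat_mult of_nat_power mult.assoc)
      with 1 show ?thesis by (simp only:)
    qed
  qed
  moreover have "int (p ^ (k + 1)) dvd U ^ h - 1"
  proof (cases "p = 2")
    case True
    then have d: "d = 2 ^ 2" using assms(1) by (auto simp: admissible_def)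
    have "2 ^ 1 dvd 2 * h" "2 * h \<noteq> 0" using assms(4) by auto
    then have "k \<ge> 1" unfolding k_def True by (intro multiplicity_geI) auto
    \<comment> \<open>\<open>h\<close> has one factor 2 less than \<open>2 h\<close>; the congruence
      of \<open>U\<close> modulo 4 instead of 2 makes up for it.\<close>
    then obtain k' where k': "k = Suc k'" by (cases k) auto
    then obtain m where "h = 2 ^ k' * m" using k(1) True by auto
    then show ?thesis using power_minus_one_dvd[of 2 2 U k' m] assms(3) by (simp add: d k' True)
  next
    case False
    then have d: "d = p" "p \<ge> 5" using assms(1) by (auto simp: admissible_def)
    have "coprime p 2" by (rule primes_coprime[OF p two_is_prime_nat False])
    then have "coprime (p ^ k) 2" by (rule coprime_power_left_iff[THEN iffD2, OF disjI1])
    then have "p ^ k dvd h" using k(1) by (simp add: coprime_dvd_mult_right_iff)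
    then obtain m where "h = p ^ k * m" by auto
    then show ?thesis using power_minus_one_dvd[of p 1 U k m] assms(3) by (simp add: d)
  qed
  ultimately have "int (p ^ (k + 1)) dvd (odd_part h U (- E) - int (2 * h + 1) * U ^ h) + int (2 * h + 1) * (U ^ h - 1)"
    by (intro dvd_add dvd_mult)
  also have "\<dots> = - int (2 * h)" unfolding L by (simp add: algebra_simps)
  finally have "int (p ^ (k + 1)) dvd int (2 * h)" by (simp only: dvd_minus_iff)
  then show False using k(2) by (simp only: int_dvd_int_iff)
qed

text \<open>A converse of \<open>power_minus_one_dvd\<close> at 2. For odd \<open>h\<close> the
  geometric sum is odd; for \<open>h = 2 m\<close> the extra factor \<open>U ^ m + 1\<close> is 2
  modulo 4 and contributes exactly one factor 2.\<close>

lemma two_adic_power_minus_one: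
  fixes U :: int
  assumes "4 dvd U - 1" "\<not> 2 ^ (s + 1) dvd U - 1" "\<not> 2 ^ (k + 1) dvd h"
  shows "\<not> 2 ^ (s + k + 1) dvd U ^ h - 1"
  using assms(3)
proof (induction h arbitrary: k rule: less_induct)
  case (less h)
  have "odd U" using assms(1) by presburger
  have "h > 0" using less.prems by (cases h) auto
  show ?case
  proof (cases "even h")
    case False
    have eq: "U ^ h - 1 = (U - 1) * (\<Sum>i<h. U ^ i)" by (rule power_diff_1_eq)
    have "[U = 1] (mod 2)" using \<open>odd U\<close> by (simp add: cong_def odd_iff_mod_2_eq_one)
    then have "[(\<Sum>i<h. U ^ i) = (\<Sum>i<h. 1 ^ i)] (mod 2)" by (intro cong_sum cong_pow)
    then have "odd (\<Sum>i<h. U ^ i)" using False by (simp add: cong_dvd_iff)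
    then have "coprime (2 ^ (s + k + 1)) (\<Sum>i<h. U ^ i)" by simp
    then have "2 ^ (s + k + 1) dvd U ^ h - 1 \<longleftrightarrow> 2 ^ (s + k + 1) dvd U - 1"
      unfolding eq by (simp add: coprime_dvd_mult_left_iff)
    moreover have "(2 :: int) ^ (s + 1) dvd 2 ^ (s + k + 1)" by (intro le_imp_power_dvd) simp
    ultimately show ?thesis using assms(2) dvd_trans by blast
  next
    case True
    then obtain m where m: "h = 2 * m" by auto
    obtain k' where k': "k = Suc k'" using less.prems m by (cases k) auto
    have nd: "\<not> 2 ^ (k' + 1) dvd m" using less.prems unfolding m k' by simp
    have "[U = 1] (mod 4)" using assms(1) by (simp add: cong_iff_dvd_diff)
    then have "[U ^ m = 1 ^ m] (mod 4)" by (rule cong_pow)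
    then have "4 dvd U ^ m - 1" by (simp add: cong_iff_dvd_diff)
    then obtain c where "U ^ m - 1 = 4 * c" ..
    then have "U ^ m = 1 + 4 * c" by simp
    then have c: "U ^ m + 1 = 2 * (2 * c + 1)" by simp
    have eq: "U ^ h - 1 = 2 * ((U ^ m - 1) * (2 * c + 1))"
    proof -
      have "U ^ h - 1 = (U ^ m - 1) * (U ^ m + 1)"
        unfolding m by (simp add: algebra_simps power_mult power2_eq_square mult_2 power_add)
      then show ?thesis unfolding c by simp
    qed
    have "2 ^ (s + k + 1) dvd U ^ h - 1 \<longleftrightarrow> 2 ^ (s + k' + 1) dvd (U ^ m - 1) * (2 * c + 1)"
    proof -
      have "(2 :: int) ^ (s + k + 1) = 2 * 2 ^ (s + k' + 1)" by (simp add: k')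
      then show ?thesis unfolding eq by (simp only: dvd_mult_cancel_left) simp
    qed
    also have "\<dots> \<longleftrightarrow> 2 ^ (s + k' + 1) dvd U ^ m - 1"
      by (intro coprime_dvd_mult_left_iff) simp
    finally show ?thesis using less.IH[of m k'] nd m \<open>h > 0\<close> by simp
  qed
qed

text \<open>Let \<open>2 ^ k\<close> be the exact power of 2 in \<open>h\<close>. All terms after
  the first are divisible by \<open>2 ^ (s + k + 1)\<close>, but the difference of the first term
  and \<open>2 h + 1\<close> is not.\<close>

lemma odd_part_ne_index:
  fixes U E :: int
  assumes "4 dvd U - 1" "\<not> 2 ^ (s + 1) dvd U - 1" "2 ^ (s + 2) dvd E" "h \<ge> 1"
  shows "odd_part h U (- E) \<noteq> int (2 * h + 1)"
proof
  assume L: "odd_part h U (- E) = int (2 * h + 1)"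
  have a: "admissible 2 4" by (simp add: admissible_def)
  define k where "k = multiplicity 2 h"
  have k: "2 ^ k dvd h" "\<not> 2 ^ (k + 1) dvd h"
    using assms(4) unfolding k_def by (simp_all add: multiplicity_dvd power_dvd_iff_le_multiplicity del: power_Suc power_add)
  then have k1: "2 ^ (k + 1) dvd 2 * h" by simp
  have "2 ^ (s + k + 1) dvd odd_part h U (- E) - int (2 * h + 1) * U ^ h"
  proof (rule odd_part_minus_head_dvd)
    fix r assume "1 \<le> r" "r \<le> h"
    obtain e where e: "E = 2 ^ (s + 2) * e" using assms(3) by auto
    have "int (2 ^ (k + 2)) dvd int (((2 * h + 1) choose (2 * r + 1)) * 4 ^ r)"
      using binomial_term_dvd[OF a \<open>1 \<le> r\<close> k1] by (simp only: int_dvd_int_iff) simp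
    moreover have "2 ^ (k + 1) dvd int (2 ^ (k + 2))" by simp
    ultimately have "2 ^ (k + 1) dvd int (((2 * h + 1) choose (2 * r + 1)) * 4 ^ r)"
      by (rule dvd_trans[rotated])
    then have 1: "2 ^ (k + 1) dvd int ((2 * h + 1) choose (2 * r + 1)) * 4 ^ r"
      by (simp only: of_nat_mult of_nat_power of_nat_numeral)
    \<comment> \<open>Of the factors of \<open>E ^ r\<close>, the part \<open>4 ^ r\<close> is spent
      on the binomial coefficient, and \<open>2 ^ s\<close> is still available.\<close>
    have "(2 :: int) ^ s dvd (2 ^ s) ^ r" using \<open>1 \<le> r\<close> by (simp add: dvd_power)
    then have "2 ^ (k + 1) * 2 ^ s dvd (int ((2 * h + 1) choose (2 * r + 1)) * 4 ^ r) * ((2 ^ s) ^ r * (- e) ^ r)"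
      by (intro mult_dvd_mono 1 dvd_mult2)
    moreover have "(- E) ^ r = 4 ^ r * ((2 ^ s) ^ r * (- e) ^ r)"
      unfolding e by (simp add: power_add mult_ac flip: power_mult_distrib)
    ultimately show "2 ^ (s + k + 1) dvd int ((2 * h + 1) choose (2 * r + 1)) * (- E) ^ r"
      by (simp add: power_add mult_ac)
  qed
  then have "2 ^ (s + k + 1) dvd int (2 * h + 1) * (U ^ h - 1)"
    unfolding L by (metis dvd_minus_iff minus_diff_eq mult.right_neutral right_diff_distrib)
  moreover have "coprime (2 ^ (s + k + 1)) (int (2 * h + 1))" by simp
  ultimately have "2 ^ (s + k + 1) dvd U ^ h - 1" by (simp only: coprime_dvd_mult_right_iff)
  then show False using two_adic_power_minus_one[OF assms(1,2) k(2)] by simp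
qed

lemma odd_part_cong_index:
  fixes U E m :: int
  assumes "m dvd E" "m dvd U - 1"
  shows "[odd_part h U (- E) = int (2 * h + 1)] (mod m)"
proof -
  have "[odd_part h U (- E) = odd_part h 1 0] (mod m)"
    using assms by (intro odd_part_cong) (auto simp: cong_iff_dvd_diff)
  moreover have "odd_part h 1 (0 :: int) = int (2 * h + 1)"
    unfolding odd_part_split by (simp add: power_0_left)
  ultimately show ?thesis by simp
qed

text \<open>Modulo 4 only \<open>2 h + 1\<close> and \<open>- 2 * ((2 h + 1) choose 3)\<close>
  survive; the binomial coefficient has the parity of \<open>h\<close>.\<close>

lemma odd_part_mod_four:
  fixes U E :: int
  assumes "4 dvd U - 1" "E mod 4 = 2"
  shows "[odd_part h U (- E) = 1] (mod 4)"
proof -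
  have "[odd_part h U (- E) = odd_part h 1 (- 2)] (mod 4)"
  proof (rule odd_part_cong)
    show "[U = 1] (mod 4)" using assms(1) by (simp add: cong_iff_dvd_diff)
    have "4 dvd - E - (- 2)" using assms(2) by presburger
    then show "[- E = - 2] (mod 4)" by (simp only: cong_iff_dvd_diff)
  qed
  also have "[odd_part h 1 (- 2 :: int) = 1] (mod 4)"
  proof (cases "h = 0")
    case True
    then show ?thesis by (simp add: odd_part_def)
  next
    case False
    let ?g = "\<lambda>r. int ((2 * h + 1) choose (2 * r + 1)) * 1 ^ (h - r) * (- 2) ^ r"
    have "(\<Sum>r=1..h. ?g r) = ?g 1 + (\<Sum>r=2..h. ?g r)"
    proof -
      have "1 \<le> h" using False by simp
      from sum.atLeast_Suc_atMost[OF this, of ?g] show ?thesis unfolding Suc_1 .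
    qed
    then have "odd_part h 1 (- 2) = int (2 * h + 1) + ?g 1 + (\<Sum>r=2..h. ?g r)"
      unfolding odd_part_split by (simp only: power_one mult_1_right add.assoc)
    moreover have "4 dvd (\<Sum>r=2..h. ?g r)"
    proof (rule dvd_sum)
      fix r assume "r \<in> {2..h}"
      then have "(- 2 :: int) ^ 2 dvd (- 2) ^ r" by (intro le_imp_power_dvd) auto
      then show "4 dvd ?g r" by (simp add: dvd_mult)
    qed
    moreover have "4 dvd int (2 * h + 1) + ?g 1 - 1"
    proof -
      have "3 * 2 * ((2 * h + 1) choose 3) = 2 * h * (2 * h + 1) * (2 * h - 1)"
        using binomial_odd_absorb[of 1 h] by (simp add: numeral_3_eq_3 mult_ac)
      then have "int (3 * 2 * ((2 * h + 1) choose 3)) = int (2 * h * (2 * h + 1) * (2 * h - 1))"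
        by (simp only:)
      then have "3 * 2 * int ((2 * h + 1) choose 3) = 2 * int h * (2 * int h + 1) * (2 * int h - 1)"
        using False by (simp only: of_nat_mult of_nat_add of_nat_numeral of_nat_1 of_nat_diff)
      then have "3 * int ((2 * h + 1) choose 3) = 4 * (int h * int h * int h) - int h"
        by (simp add: algebra_simps)
      then have "4 dvd 2 * int h - 2 * int ((2 * h + 1) choose 3)" by presburger
      moreover have "?g 1 = - 2 * int ((2 * h + 1) choose 3)" by (simp add: numeral_3_eq_3 algebra_simps)
      ultimately show ?thesis by (simp only:) simp
    qed
    ultimately show ?thesis unfolding cong_iff_dvd_diff
      using dvd_add[of 4 "int (2 * h + 1) + ?g 1 - 1" "\<Sum>r=2..h. ?g r"]
      by (simp only: algebra_simps)
  qed
  finally show ?thesis .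
qed

text \<open>A prime divisor of the Lucas number divides \<open>D\<close>, hence all terms but the
  first, so it can only be \<open>q = 2 h + 1\<close>. It occurs just once: \<open>q\<close> is not
  3, and for \<open>q > 3\<close> the later terms vanish modulo \<open>q * q\<close>.\<close>

lemma odd_part_values:
  fixes X E D :: int
  assumes "prime (2 * h + 1)" "D dvd E" "coprime X D" "\<not> 3 dvd D"
    "odd_part h (X\<^sup>2) (- E) dvd D ^ g"
  shows "\<bar>odd_part h (X\<^sup>2) (- E)\<bar> = 1 \<or>
    int (2 * h + 1) dvd D \<and> \<bar>odd_part h (X\<^sup>2) (- E)\<bar> = int (2 * h + 1)"
proof -
  define L where "L = odd_part h (X\<^sup>2) (- E)"
  define q where "q = 2 * h + 1"
  have q: "prime (int q)" using assms(1) by (simp only: q_def prime_int_nat_transfer nat_int) simp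
  have only: "p = int q \<and> p dvd D" if p: "prime p" "p dvd L" for p
  proof -
    have "p dvd D ^ g" using p(2) assms(5) unfolding L_def by (rule dvd_trans)
    then have pD: "p dvd D" using p(1) prime_dvd_power by blast
    then have "p dvd E" using assms(2) by (rule dvd_trans)
    then have "p dvd L - int q * (X\<^sup>2) ^ h" unfolding L_def q_def
      by (intro odd_part_minus_head_dvd) (auto intro!: dvd_mult dvd_power_le[of _ _ 1, simplified])
    then have "p dvd int q * (X\<^sup>2) ^ h" using p(2) by (simp add: dvd_diff_right_iff)
    moreover have "\<not> p dvd X" using assms(3) pD p(1) by (meson coprime_common_divisor not_prime_unit)
    ultimately have "p dvd int q" using p(1) by (metis prime_dvd_mult_iff prime_dvd_power)
    then show ?thesis using p(1) q pD primes_dvd_imp_eq by blast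
  qed
  show ?thesis
  proof (cases "is_unit L")
    case True
    then show ?thesis by (simp add: L_def)
  next
    case False
    have "D \<noteq> 0" using assms(4) by auto
    then have "L \<noteq> 0" using assms(5) unfolding L_def by auto
    obtain p where p: "prime p" "p dvd L" using False \<open>L \<noteq> 0\<close> prime_divisor_exists by blast
    have qL: "int q dvd L" "int q dvd D" using only[OF p] p by auto
    then have "q \<noteq> 3" using assms(4) by auto
    have "h \<noteq> 0" using assms(1) by (intro notI) simp
    have "h \<noteq> 1" using \<open>q \<noteq> 3\<close> by (auto simp: q_def)
    with \<open>h \<noteq> 0\<close> have h: "h \<ge> 2" by simp
    obtain L' where L': "L = int q * L'" using qL(1) by auto
    have qE: "int q dvd E" using qL(2) assms(2) by (rule dvd_trans)
    have "(int q)\<^sup>2 dvd L - int q * (X\<^sup>2) ^ h" unfolding L_def q_def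
    proof (rule odd_part_minus_head_dvd)
      fix r assume r: "1 \<le> r" "r \<le> h"
      show "(int (2 * h + 1))\<^sup>2 dvd int ((2 * h + 1) choose (2 * r + 1)) * (- E) ^ r"
      \<comment> \<open>The last binomial coefficient is 1, but \<open>E ^ h\<close> suffices there
        as \<open>h >= 2\<close>; the other coefficients supply one factor \<open>q\<close>.\<close>
      proof (cases "r = h")
        case True
        have "(- E)\<^sup>2 dvd (- E) ^ r" using h True by (intro le_imp_power_dvd) simp
        moreover have "(int q)\<^sup>2 dvd (- E)\<^sup>2" using qE by (intro dvd_power_same) simp
        ultimately have "(int q)\<^sup>2 dvd (- E) ^ r" by (rule dvd_trans[rotated])
        then show ?thesis unfolding q_def by (rule dvd_mult)
      next
        case False
        then have "2 * h + 1 dvd (2 * h + 1) choose (2 * r + 1)"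
          using r by (intro dvd_choose_prime assms(1)) auto
        then have 1: "int q dvd int ((2 * h + 1) choose (2 * r + 1))" unfolding q_def by (simp only: int_dvd_int_iff)
        have "- E dvd (- E) ^ r" using r by (intro dvd_power) auto
        moreover have "int q dvd - E" using qE by simp
        ultimately have "int q dvd (- E) ^ r" by (rule dvd_trans[rotated])
        with 1 show ?thesis unfolding power2_eq_square q_def[symmetric] by (intro mult_dvd_mono)
      qed
    qed
    then have "int q * int q dvd int q * (L' - (X\<^sup>2) ^ h)" unfolding L' by (simp add: power2_eq_square algebra_simps)
    then have d: "int q dvd L' - (X\<^sup>2) ^ h" using q by simp
    have "\<not> int q dvd X" using assms(3) qL(2) q by (meson coprime_common_divisor not_prime_unit)
    then have "\<not> int q dvd (X\<^sup>2) ^ h" using q prime_dvd_power by blast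
    then have nd: "\<not> int q dvd L'" using d dvd_diff[of "int q" L' "L' - (X\<^sup>2) ^ h"] by auto
    have "is_unit L'"
    proof (rule ccontr)
      assume "\<not> is_unit L'"
      moreover have "L' \<noteq> 0" using \<open>L \<noteq> 0\<close> L' by auto
      ultimately obtain p where "prime p" "p dvd L'" using prime_divisor_exists by blast
      then show False using only[of p] nd by (auto simp: L')
    qed
    then have "\<bar>L\<bar> = int q" by (simp add: L' abs_mult)
    then show ?thesis using qL(2) by (simp add: L_def q_def)
  qed
qed

lemma square_mod_8:
  assumes "odd (u :: int)"
  shows "u\<^sup>2 mod 8 = 1"
proof -
  obtain k where k: "u = 2 * k + 1" using assms by (elim oddE)
  have "even (k * (k + 1))" by simp
  then obtain j where "k * (k + 1) = 2 * j" by (elim evenE)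
  then have "u\<^sup>2 = 8 * j + 1" unfolding k by (simp add: power2_eq_square algebra_simps)
  then show ?thesis by simp
qed

lemma square_mod_3: "(u :: int)\<^sup>2 mod 3 = (if 3 dvd u then 0 else 1)"
proof -
  define r where "r = u mod 3"
  have "u\<^sup>2 mod 3 = r\<^sup>2 mod 3" "3 dvd u \<longleftrightarrow> r = 0" by (auto simp: r_def power_mod)
  moreover have "r = 0 \<or> r = 1 \<or> r = 2" unfolding r_def by presburger
  ultimately show ?thesis by auto
qed

lemma dvd_power_minus_one: "(n :: int) - 1 dvd n ^ k - 1"
  by (simp add: power_diff_1_eq)

section \<open>Excluding a root of odd prime index\<close>

text \<open>With \<open>q = 2 h + 1\<close>, the values 1, -1, \<open>- q\<close> and
  \<open>q\<close> of the Lucas number \<open>L\<close> are excluded in this order. The second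
  alternative of \<open>cases\<close> serves \<open>n mod 4 = 3\<close> with
  \<open>x = 1\<close>.\<close>

lemma no_prime_power_root:
  fixes n D X Y :: int and h g M :: nat
  assumes n: "n = D + 1" and q: "prime (2 * h + 1)" and N: "X\<^sup>2 + D * Y\<^sup>2 = n ^ M" and M: "odd M"
    and cop: "coprime X D" and D: "even D" "\<not> 3 dvd D" and X3: "3 dvd n \<longrightarrow> \<not> 3 dvd X"
    and YL: "\<bar>Y * odd_part h (X\<^sup>2) (- (D * Y\<^sup>2))\<bar> = D ^ g"
    and cases: "4 dvd D \<and> (3 dvd n \<or> n mod 24 = 17) \<or> D mod 4 = 2 \<and> g = 0 \<and> D > 2"
  shows False
proof -
  define E where "E = D * Y\<^sup>2"
  define L where "L = odd_part h (X\<^sup>2) (- E)"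
  have h: "h \<ge> 1" using q by (cases h) auto
  have DE: "D dvd E" by (simp add: E_def)
  have "\<bar>L\<bar> dvd D ^ g" using YL unfolding L_def E_def abs_mult by (metis dvd_triv_right)
  then have Ldvd: "L dvd D ^ g" by simp
  have "odd X" using cop D(1) by (meson coprime_common_divisor not_is_unit_0 odd_one)
  then have X8: "X\<^sup>2 mod 8 = 1" by (rule square_mod_8)
  then have U4: "4 dvd X\<^sup>2 - 1" by presburger
  have UD: "D dvd X\<^sup>2 - 1"
  proof -
    have "n - 1 = D" using n by simp
    then have "D dvd n ^ M - 1" using dvd_power_minus_one[of n M] by (simp only:)
    then have "D dvd n ^ M - 1 - D * Y\<^sup>2" by (rule dvd_diff) simp
    then show ?thesis by (simp flip: N)
  qed
  have ne1: "L \<noteq> 1"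
  proof -
    have "\<exists>p d. admissible p d \<and> int d dvd D \<and> int d dvd X\<^sup>2 - 1"
    proof (cases "4 dvd D")
      case True
      then show ?thesis using U4 by (intro exI[of _ 2] exI[of _ 4]) (simp add: admissible_def)
    next
      case False
      then have D2: "D mod 4 = 2" "D > 2" using cases by auto
      \<comment> \<open>\<open>D\<close> is twice an odd number \<open>m > 1\<close>, and every
        prime divisor of \<open>m\<close> is at least 5.\<close>
      define m where "m = nat (D div 2)"
      have "int m = D div 2" using D2(2) by (simp add: m_def)
      then have m: "D = 2 * int m" "m \<noteq> 1" "odd m" using D2 by presburger+
      obtain p where p: "prime p" "p dvd m" using prime_factor_nat[OF m(2)] by blast
      have pD: "int p dvd D" unfolding m(1) using p(2) by simp
      have "p \<noteq> 2" using p(2) m(3) by auto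
      moreover have "p \<noteq> 3" using pD D(2) by auto
      moreover have "p \<noteq> 4" using p(1) by (auto simp: prime_nat_iff dest!: spec[of _ "2::nat"])
      ultimately have "p \<ge> 5" using prime_ge_2_nat[OF p(1)] by linarith
      then show ?thesis using p(1) pD UD by (intro exI[of _ p]) (auto simp: admissible_def intro: dvd_trans)
    qed
    then obtain p d where "admissible p d" "int d dvd D" "int d dvd X\<^sup>2 - 1" by blast
    then show ?thesis unfolding L_def using DE h by (intro odd_part_ne_one) (auto intro: dvd_trans)
  qed
  have nem1: "L \<noteq> - 1"
  proof
    assume L: "L = - 1"
    consider "3 dvd n" | "n mod 24 = 17" | "D mod 4 = 2" "g = 0" using cases by blast
    then show False
    proof cases
      case 1
      \<comment> \<open>Modulo 3 both arguments of the Lucas number are 1, so it is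
        \<open>4 ^ h = 1\<close>.\<close>
      then have "X\<^sup>2 mod 3 = 1" using X3 by (simp add: square_mod_3)
      moreover have "3 dvd X\<^sup>2 + E" unfolding E_def N using 1 M by (intro dvd_power_le[of _ _ 1, simplified]) (auto simp: odd_pos Suc_leI)
      ultimately have "[X\<^sup>2 = 1] (mod 3)" "[- E = 1] (mod 3)" by (simp_all add: cong_def) presburger
      then have "[L = odd_part h 1 1] (mod 3)" unfolding L_def by (rule odd_part_cong)
      also have "[odd_part h 1 1 = 1 ^ h] (mod (3 :: int))"
        unfolding odd_part_ones by (intro cong_pow) (simp add: cong_def)
      finally show False by (simp add: L cong_def)
    next
      case 2
      \<comment> \<open>Modulo 8 the Lucas number is its index, which is therefore 7. Modulo 3 the
        sum of the squares of \<open>X\<close> and \<open>Y\<close> is 2, so both squares are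
        1.\<close>
      then have "8 dvd D" "D mod 3 = 1" using n by presburger+
      have "8 dvd X\<^sup>2 - 1" using X8 by presburger
      then have "[L = int (2 * h + 1)] (mod 8)" unfolding L_def
        using \<open>8 dvd D\<close> DE by (intro odd_part_cong_index) (auto intro: dvd_trans)
      then have q8: "(2 * h + 1) mod 8 = 7" by (simp add: L cong_def) presburger
      have "[n = - 1] (mod 3)" using 2 by (simp add: cong_def) presburger
      then have "[n ^ M = (- 1) ^ M] (mod 3)" by (rule cong_pow)
      then have "[X\<^sup>2 + E = - 1] (mod 3)" using M by (simp add: N E_def)
      moreover have "E mod 3 = Y\<^sup>2 mod 3" unfolding E_def using \<open>D mod 3 = 1\<close> by (metis mod_mult_left_eq mult_1)
      ultimately have "X\<^sup>2 mod 3 = 1" "E mod 3 = 1"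
        using square_mod_3[of X] square_mod_3[of Y] by (auto simp: cong_def split: if_splits)
      then have "[X\<^sup>2 = 1] (mod 3)" "[- E = - 1] (mod 3)" by (simp_all add: cong_def) presburger
      then have "[L = odd_part h 1 (- 1)] (mod 3)" unfolding L_def by (rule odd_part_cong)
      also have "[odd_part h 1 (- 1) = 1] (mod (3 :: int))" by (rule odd_part_one_minus_one[OF q8])
      finally show False by (simp add: L cong_def)
    next
      case 3
      then have "\<bar>Y\<bar> * \<bar>L\<bar> = 1" using YL unfolding L_def E_def by (simp add: abs_mult)
      then have "\<bar>Y\<bar> = 1" using L by simp
      then have "Y\<^sup>2 = 1" by (metis power2_abs power_one)
      then have "E mod 4 = 2" using 3 by (simp add: E_def)
      then have "[L = 1] (mod 4)" unfolding L_def by (intro odd_part_mod_four U4)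
      then show False by (simp add: L cong_def)
    qed
  qed
  have "int (2 * h + 1) dvd D \<and> \<bar>L\<bar> = int (2 * h + 1)"
    using odd_part_values[OF q DE cop D(2) Ldvd[unfolded L_def]] ne1 nem1 unfolding L_def by linarith
  then have absL: "\<bar>L\<bar> = int (2 * h + 1)" by blast
  have "g \<noteq> 0"
  proof
    assume "g = 0"
    then have "\<bar>L\<bar> = 1" using Ldvd by simp
    then show False using absL h by simp
  qed
  then have D4: "4 dvd D" using cases by blast
  have "[L = int (2 * h + 1)] (mod 4)" unfolding L_def
    using D4 DE U4 by (intro odd_part_cong_index) (auto intro: dvd_trans)
  moreover have "\<not> [- int (2 * h + 1) = int (2 * h + 1)] (mod 4)" by (simp add: cong_def) presburger
  ultimately have L: "L = int (2 * h + 1)" using absL by (metis abs_if minus_minus)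
  have "even (\<bar>Y * L\<bar>)" using YL \<open>g \<noteq> 0\<close> D(1) unfolding L_def E_def by simp
  then have "even Y" unfolding L by simp
  have "D \<noteq> 0" using D(2) by auto
  define s where "s = multiplicity 2 D"
  have s: "2 ^ s dvd D" "\<not> 2 ^ (s + 1) dvd D"
    using \<open>D \<noteq> 0\<close> unfolding s_def by (simp_all add: multiplicity_dvd power_dvd_iff_le_multiplicity del: power_Suc)
  have "2\<^sup>2 dvd Y\<^sup>2" using \<open>even Y\<close> by (intro dvd_power_same)
  then have E: "2 ^ (s + 2) dvd E" unfolding power_add E_def by (intro mult_dvd_mono s(1))
  \<comment> \<open>\<open>n ^ M - 1\<close> is \<open>D\<close> times an odd sum and
    \<open>Y\<close> is even, so \<open>X * X - 1\<close> has the same power of 2 as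
    \<open>D\<close>, while \<open>E\<close> has at least two more factors 2.\<close>
  have "\<not> 2 ^ (s + 1) dvd X\<^sup>2 - 1"
  proof -
    have "X\<^sup>2 - 1 = D * ((\<Sum>i<M. n ^ i) - Y\<^sup>2)"
    proof -
      have "X\<^sup>2 - 1 = n ^ M - 1 - D * Y\<^sup>2" by (simp flip: N)
      also have "n ^ M - 1 = D * (\<Sum>i<M. n ^ i)" unfolding power_diff_1_eq by (simp add: n)
      finally show ?thesis by (simp add: algebra_simps)
    qed
    moreover have "odd ((\<Sum>i<M. n ^ i) - Y\<^sup>2)"
    proof -
      have "[n = 1] (mod 2)" using D(1) n by (simp add: cong_iff_dvd_diff)
      then have "[(\<Sum>i<M. n ^ i) = (\<Sum>i<M. 1 ^ i)] (mod 2)" by (intro cong_sum cong_pow)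
      then have "odd (\<Sum>i<M. n ^ i)" using M by (simp add: cong_dvd_iff)
      then show ?thesis using \<open>even Y\<close> by simp
    qed
    then have "coprime (2 ^ (s + 1)) ((\<Sum>i<M. n ^ i) - Y\<^sup>2)" by simp
    ultimately show ?thesis using s(2) by (simp only: coprime_dvd_mult_left_iff) simp
  qed
  from odd_part_ne_index[OF U4 this E h] L show False unfolding L_def by simp
qed

text \<open>By Thue's pigeonhole argument \<open>b\<close> has a small multiple of the form \<open>u\<^sup>2 - 6 v\<^sup>2\<close>; congruences
  exclude every possible cofactor.\<close>
lemma six_not_square_mod:
  fixes b c :: int
  assumes "b > 0" "b mod 24 = 7" "b dvd c\<^sup>2 - 6"
  shows False
proof -
  define K where "K = floor_sqrt (nat b)"
  have K: "int K * int K \<le> b" "b < (int K + 1) * (int K + 1)"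
  proof -
    have "K\<^sup>2 \<le> nat b" "nat b < (Suc K)\<^sup>2" unfolding K_def
      by (rule floor_sqrt_power2_le, rule Suc_floor_sqrt_power2_gt)
    then show "int K * int K \<le> b" "b < (int K + 1) * (int K + 1)" using assms(1)
      by (simp_all add: power2_eq_square algebra_simps flip: of_nat_mult of_nat_add)
  qed
  let ?f = "\<lambda>(i, j). (int i - c * int j) mod b"
  let ?A = "{..K} \<times> {..K}"
  have "card (?f ` ?A) \<le> card {0..<b}" using assms(1) by (intro card_mono) auto
  also have "\<dots> = nat b" by simp
  also have "\<dots> < card ?A" using K(2) by (simp add: nat_less_iff assms(1) less_imp_le algebra_simps)
  finally have "\<not> inj_on ?f ?A" by (rule pigeonhole)
  then obtain i j i' j' where ij: "i \<le> K" "j \<le> K" "i' \<le> K" "j' \<le> K" "(i, j) \<noteq> (i', j')"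
    "(int i - c * int j) mod b = (int i' - c * int j') mod b"
    unfolding inj_on_def by auto
  define u where "u = int i - int i'"
  define v where "v = int j - int j'"
  have "b dvd (int i - c * int j) - (int i' - c * int j')" using ij(6) by (simp add: mod_eq_dvd_iff)
  then have 1: "b dvd u - c * v" by (simp add: u_def v_def algebra_simps)
  have "u\<^sup>2 - 6 * v\<^sup>2 = (u - c * v) * (u + c * v) + (c\<^sup>2 - 6) * v\<^sup>2"
    by (simp add: algebra_simps power2_eq_square)
  then have "b dvd u\<^sup>2 - 6 * v\<^sup>2" using 1 assms(3) by simp
  then obtain k where k: "u\<^sup>2 - 6 * v\<^sup>2 = b * k" by auto
  have "\<bar>u\<bar> \<le> int K" "\<bar>v\<bar> \<le> int K" using ij by (auto simp: u_def v_def)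
  then have "\<bar>u\<bar> * \<bar>u\<bar> \<le> int K * int K" "\<bar>v\<bar> * \<bar>v\<bar> \<le> int K * int K" by (intro mult_mono; simp)+
  then have uv: "u\<^sup>2 \<le> b" "v\<^sup>2 \<le> b" using K(1) by (simp_all add: power2_eq_square)
  have "b * k \<le> b * 1" "b * (- 6) \<le> b * k" using uv k zero_le_power2[of u] zero_le_power2[of v] by linarith+
  then have "k \<le> 1" "- 6 \<le> k" using assms(1) by (simp_all only: mult_le_cancel_left_pos)
  have "u \<noteq> 0 \<or> v \<noteq> 0" using ij(5) by (auto simp: u_def v_def)
  have k0: "k \<noteq> 0"
  proof
    assume "k = 0"
    then have eq: "u\<^sup>2 = 6 * v\<^sup>2" using k by simp
    then have "u \<noteq> 0" "v \<noteq> 0" using \<open>u \<noteq> 0 \<or> v \<noteq> 0\<close> by auto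
    \<comment> \<open>The 2-adic valuation is even on the left and odd on the right.\<close>
    have "multiplicity 2 (u\<^sup>2) = 2 * multiplicity 2 u" using \<open>u \<noteq> 0\<close>
      by (intro prime_elem_multiplicity_power_distrib) auto
    moreover have "multiplicity 2 (6 * v\<^sup>2) = 1 + 2 * multiplicity 2 v"
    proof -
      have "multiplicity 2 (6 * v\<^sup>2) = multiplicity 2 (6 :: int) + multiplicity 2 (v\<^sup>2)"
        using \<open>v \<noteq> 0\<close> by (intro prime_elem_multiplicity_mult_distrib) auto
      moreover have "multiplicity 2 (v\<^sup>2) = 2 * multiplicity 2 v" using \<open>v \<noteq> 0\<close>
        by (intro prime_elem_multiplicity_power_distrib) auto
      moreover have "multiplicity 2 (6 :: int) = 1" by (intro multiplicity_eqI) auto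
      ultimately show ?thesis by simp
    qed
    ultimately have "2 * multiplicity 2 u = 1 + 2 * multiplicity 2 v" using eq by simp
    then show False by presburger
  qed
  have sq16: "w\<^sup>2 mod 16 \<in> {0, 1, 4, 9}" for w :: int
  proof -
    define r where "r = w mod 16"
    have "w\<^sup>2 mod 16 = r\<^sup>2 mod 16" by (simp add: r_def power_mod)
    moreover have "r \<in> set [0..15]" by (simp add: r_def)
    ultimately show ?thesis by (auto simp: upto_rec1)
  qed
  have sq9: "w\<^sup>2 mod 9 \<in> {0, 1, 4, 7}" for w :: int
  proof -
    define r where "r = w mod 9"
    have "w\<^sup>2 mod 9 = r\<^sup>2 mod 9" by (simp add: r_def power_mod)
    moreover have "r \<in> set [0..8]" by (simp add: r_def)
    ultimately show ?thesis by (auto simp: upto_rec1)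
  qed
  have sq8: "w\<^sup>2 mod 8 \<in> {0, 1, 4}" for w :: int
  proof -
    define r where "r = w mod 8"
    have "w\<^sup>2 mod 8 = r\<^sup>2 mod 8" by (simp add: r_def power_mod)
    moreover have "r \<in> set [0..7]" by (simp add: r_def)
    ultimately show ?thesis by (auto simp: upto_rec1)
  qed
  have sq3: "w\<^sup>2 mod 3 \<in> {0, 1}" for w :: int
  proof -
    define r where "r = w mod 3"
    have "w\<^sup>2 mod 3 = r\<^sup>2 mod 3" by (simp add: r_def power_mod)
    moreover have "r \<in> set [0..2]" by (simp add: r_def)
    ultimately show ?thesis by (auto simp: upto_rec1)
  qed
  obtain t where t: "b = 24 * t + 7" using assms(2) by (metis mult_div_mod_eq)
  \<comment> \<open>The moduli are 3 for \<open>k = -1, -4\<close>, 8 for \<open>k = 1, -5\<close>,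
    9 for \<open>k = -3\<close> and 16 for \<open>k = -2, -6\<close>; in each case the term
    \<open>24 k t\<close> drops out.\<close>
  have "k \<in> {- 6, - 5, - 4, - 3, - 2, - 1, 1}" using \<open>k \<le> 1\<close> \<open>- 6 \<le> k\<close> k0 by auto
  moreover have "k \<noteq> 1"
  proof
    assume "k = 1"
    then have "u\<^sup>2 = (3 * t + 0) * 8 + (6 * v\<^sup>2 + 7)" using k unfolding t by simp
    then have "u\<^sup>2 mod 8 = (6 * v\<^sup>2 + 7) mod 8" by (simp only: mod_mult_self3)
    also have "\<dots> = (6 * (v\<^sup>2 mod 8) + 7) mod 8" by (metis mod_add_left_eq mod_mult_right_eq)
    finally have "u\<^sup>2 mod 8 = (6 * (v\<^sup>2 mod 8) + 7) mod 8" .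
    then show False using sq8[of u] sq8[of v] by auto
  qed
  moreover have "k \<noteq> - 1"
  proof
    assume "k = - 1"
    then have "u\<^sup>2 = (2 * v\<^sup>2 + - 8 * t - 3) * 3 + 2" using k unfolding t by simp
    then have "u\<^sup>2 mod 3 = 2 mod 3" by (simp only: mod_mult_self3)
    then show False using sq3[of u] by auto
  qed
  moreover have "k \<noteq> - 2"
  proof
    assume "k = - 2"
    then have "u\<^sup>2 = (- 3 * t - 1) * 16 + (6 * v\<^sup>2 + 2)" using k unfolding t by simp
    then have "u\<^sup>2 mod 16 = (6 * v\<^sup>2 + 2) mod 16" by (simp only: mod_mult_self3)
    also have "\<dots> = (6 * (v\<^sup>2 mod 16) + 2) mod 16" by (metis mod_add_left_eq mod_mult_right_eq)
    finally have "u\<^sup>2 mod 16 = (6 * (v\<^sup>2 mod 16) + 2) mod 16" .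
    then show False using sq16[of u] sq16[of v] by auto
  qed
  moreover have "k \<noteq> - 3"
  proof
    assume "k = - 3"
    then have "u\<^sup>2 = (- 8 * t - 3) * 9 + (6 * v\<^sup>2 + 6)" using k unfolding t by simp
    then have "u\<^sup>2 mod 9 = (6 * v\<^sup>2 + 6) mod 9" by (simp only: mod_mult_self3)
    also have "\<dots> = (6 * (v\<^sup>2 mod 9) + 6) mod 9" by (metis mod_add_left_eq mod_mult_right_eq)
    finally have "u\<^sup>2 mod 9 = (6 * (v\<^sup>2 mod 9) + 6) mod 9" .
    then show False using sq9[of u] sq9[of v] by auto
  qed
  moreover have "k \<noteq> - 4"
  proof
    assume "k = - 4"
    then have "u\<^sup>2 = (2 * v\<^sup>2 + - 32 * t - 10) * 3 + 2" using k unfolding t by simp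
    then have "u\<^sup>2 mod 3 = 2 mod 3" by (simp only: mod_mult_self3)
    then show False using sq3[of u] by auto
  qed
  moreover have "k \<noteq> - 5"
  proof
    assume "k = - 5"
    then have "u\<^sup>2 = (- 15 * t - 5) * 8 + (6 * v\<^sup>2 + 5)" using k unfolding t by simp
    then have "u\<^sup>2 mod 8 = (6 * v\<^sup>2 + 5) mod 8" by (simp only: mod_mult_self3)
    also have "\<dots> = (6 * (v\<^sup>2 mod 8) + 5) mod 8" by (metis mod_add_left_eq mod_mult_right_eq)
    finally have "u\<^sup>2 mod 8 = (6 * (v\<^sup>2 mod 8) + 5) mod 8" .
    then show False using sq8[of u] sq8[of v] by auto
  qed
  moreover have "k \<noteq> - 6"
  proof
    assume "k = - 6"
    then have "u\<^sup>2 = (- 9 * t - 3) * 16 + (6 * v\<^sup>2 + 6)" using k unfolding t by simp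
    then have "u\<^sup>2 mod 16 = (6 * v\<^sup>2 + 6) mod 16" by (simp only: mod_mult_self3)
    also have "\<dots> = (6 * (v\<^sup>2 mod 16) + 6) mod 16" by (metis mod_add_left_eq mod_mult_right_eq)
    finally have "u\<^sup>2 mod 16 = (6 * (v\<^sup>2 mod 16) + 6) mod 16" .
    then show False using sq16[of u] sq16[of v] by auto
  qed
  ultimately show False by blast
qed

section \<open>A lower bound for the exponent on the right-hand side\<close>

lemma power_one_plus_le_exp:
  assumes "(t :: real) \<ge> 0"
  shows "(1 + t) ^ k \<le> exp (t * real k)"
proof -
  have "(1 + t) ^ k \<le> exp t ^ k" using assms by (intro power_mono exp_ge_add_one_self) auto
  then show ?thesis by (simp add: exp_of_nat2_mult)
qed

text \<open>Put \<open>\<theta> = m / a\<close>. Divided by \<open>a ^ m\<close>, the left side is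
  at most \<open>exp (3 \<theta>)\<close>, by convexity at most
  \<open>1 + \<theta> (exp 3 - 1) < 1 + 20 \<theta>\<close>, and this is at most
  \<open>1 + m\<close> for \<open>a >= 20\<close>. The small values are computed.\<close>

lemma power_lt_affine:
  fixes a m :: nat
  assumes "1 \<le> m" "m + 3 \<le> a" "a \<ge> 20 \<or> a \<in> {8, 10, 14, 16}"
  shows "(a + 3) ^ m < (m + 1) * a ^ m"
proof (cases "a \<ge> 20")
  case True
  define \<theta> where "\<theta> = real m / real a"
  have \<theta>: "0 < \<theta>" "\<theta> \<le> 1" using assms by (auto simp: \<theta>_def)
  have "exp 3 = (exp 1 :: real) ^ 3" by (simp flip: exp_of_nat_mult)
  also have "\<dots> \<le> (272 / 100) ^ 3" using e_less_272 by (intro power_mono) auto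
  also have "\<dots> < (21 :: real)" by (simp add: power3_eq_cube)
  finally have e3: "exp (3::real) < 21" .
  have "(1 + 3 / real a) ^ m \<le> exp (3 / real a * real m)" by (rule power_one_plus_le_exp) simp
  also have "3 / real a * real m = (1 - \<theta>) *\<^sub>R 0 + \<theta> *\<^sub>R 3" by (simp add: \<theta>_def)
  also have "exp \<dots> \<le> (1 - \<theta>) * exp 0 + \<theta> * exp 3"
    using \<theta> by (intro convex_onD[OF exp_convex]) auto
  also have "\<dots> < 1 + \<theta> * 20" using mult_strict_left_mono[OF e3 \<theta>(1)] by (simp add: algebra_simps)
  also have "\<dots> \<le> 1 + \<theta> * real a" using True \<theta> by simp
  also have "\<dots> = real m + 1" using True by (simp add: \<theta>_def)
  finally have "(1 + 3 / real a) ^ m * real a ^ m < (real m + 1) * real a ^ m"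
    using True by (intro mult_strict_right_mono) auto
  moreover have "(1 + 3 / real a) ^ m * real a ^ m = real ((a + 3) ^ m)"
    using True by (simp add: field_simps flip: power_mult_distrib)
  ultimately have "real ((a + 3) ^ m) < real ((m + 1) * a ^ m)" by (simp add: algebra_simps)
  then show ?thesis by (simp only: of_nat_less_iff)
next
  case False
  have "m \<in> {1..13}" using assms False by auto
  then have "m \<in> set [1..<14]" by simp
  then show ?thesis using False assms(2,3) by (auto simp: upt_rec)
qed

text \<open>If \<open>z <= n - 3\<close>, then powers such as \<open>(1 + 1 / a) ^ z\<close> stay
  below 8, which rules out \<open>x > z\<close> and \<open>x < z\<close>. For \<open>x = z\<close>,
  Bernoulli gives \<open>n ^ z - a ^ z >= z * a ^ (z - 1)\<close>, which exceeds
  \<open>(n + 2) ^ (z - 1)\<close>.\<close>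

lemma exponent_lower_bound:
  fixes n x y z :: nat
  assumes "n \<ge> 9" "\<not> 3 dvd n - 1" "odd n" "y > 0" and eq: "(n - 1) ^ x + (n + 2) ^ y = n ^ z"
  shows "n \<le> z + 2"
proof (rule ccontr)
  assume "\<not> n \<le> z + 2"
  then have zn: "z + 3 \<le> n" by simp
  define a where "a = n - 1"
  have a: "n = a + 1" "a \<ge> 8" using assms(1) by (auto simp: a_def)
  have eq': "a ^ x + (n + 2) ^ y = n ^ z" using eq by (simp add: a_def)
  have apos: "a ^ x > 0" using a by simp
  have "(n + 2) ^ y < n ^ z" using eq' apos by linarith
  also have "\<dots> \<le> (n + 2) ^ z" by (intro power_mono) auto
  finally have yz: "y < z" by (simp add: power_strict_increasing_iff)
  then obtain m where m: "z = Suc m" by (cases z) auto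
  have ym: "y \<le> m" using yz m by simp
  have m1: "1 \<le> m" using ym assms(4) by simp
  have b: "(n + 2) ^ y \<le> (n + 2) ^ m" using ym by (intro power_increasing) auto
  consider "x \<ge> z + 1" | "x < z" | "x = z" by linarith
  then show False
  proof cases
    case 1
    have "a ^ (z + 1) \<le> a ^ x" using 1 a(2) by (intro power_increasing) auto
    also have "\<dots> \<le> n ^ z" using eq' by simp
    finally have "real (a ^ (z + 1)) \<le> real (n ^ z)" by (simp only: of_nat_le_iff)
    moreover have "real (n ^ z) = (1 + 1 / real a) ^ z * real a ^ z"
      using a(2) by (simp add: a(1) field_simps flip: power_mult_distrib)
    ultimately have "real a \<le> (1 + 1 / real a) ^ z" using a(2) by simp
    also have "\<dots> \<le> exp (1 / real a * real z)" by (rule power_one_plus_le_exp) simp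
    also have "\<dots> \<le> exp 1" using zn a by simp
    also have "\<dots> < 8" using e_less_272 by simp
    finally show False using a(2) by simp
  next
    case 2
    have "a ^ x \<le> n ^ x" using a(1) by (intro power_mono) auto
    also have "\<dots> \<le> n ^ m" using 2 m assms(1) by (intro power_increasing) auto
    finally have "a ^ x \<le> n ^ m" .
    moreover have "n ^ z = n * n ^ m" by (simp add: m)
    ultimately have "n * n ^ m \<le> n ^ m + (n + 2) ^ m" using eq' b by linarith
    then have "a * n ^ m \<le> (n + 2) ^ m" by (simp add: a(1))
    then have "real (a * n ^ m) \<le> real ((n + 2) ^ m)" by (simp only: of_nat_le_iff)
    moreover have "real ((n + 2) ^ m) = (1 + 2 / real n) ^ m * real n ^ m"
      using assms(1) by (simp add: field_simps flip: power_mult_distrib)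
    ultimately have "real a \<le> (1 + 2 / real n) ^ m" using assms(1) by simp
    also have "\<dots> \<le> exp (2 / real n * real m)" by (rule power_one_plus_le_exp) simp
    also have "\<dots> \<le> exp 2" using zn m by (simp add: field_simps)
    also have "exp (2 :: real) = exp 1 ^ 2" by (simp flip: exp_of_nat_mult)
    also have "\<dots> \<le> (272 / 100) ^ 2" using e_less_272 by (intro power_mono) auto
    also have "\<dots> < 8" by (simp add: power2_eq_square)
    finally show False using a(2) by simp
  next
    case 3
    have "a ^ Suc m + Suc m * a ^ m \<le> n ^ Suc m"
    proof -
      have "(1 + real m + 1 * 0) / real a + 1 \<le> (1 + 1 / real a) ^ Suc m"
        using Bernoulli_inequality[of "1 / real a" "Suc m"] a(2) by (simp add: field_simps)
      then have "((1 + real m) / real a + 1) * real a ^ Suc m \<le> (1 + 1 / real a) ^ Suc m * real a ^ Suc m"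
        by (intro mult_right_mono) auto
      also have "\<dots> = real (n ^ Suc m)"
        using a(2) by (simp add: a(1) field_simps flip: power_mult_distrib power_Suc)
      also have "((1 + real m) / real a + 1) * real a ^ Suc m = real (a ^ Suc m + Suc m * a ^ m)"
        using a(2) by (simp add: field_simps)
      finally show ?thesis by (simp only: of_nat_le_iff)
    qed
    then have "Suc m * a ^ m \<le> (n + 2) ^ y" using eq' 3 m by simp
    also have "\<dots> \<le> (a + 3) ^ m" using b by (simp add: a(1) numeral_3_eq_3)
    also have "\<dots> < (m + 1) * a ^ m"
    proof (rule power_lt_affine[OF m1])
      show "m + 3 \<le> a" using zn m a by simp
      have "even a" "\<not> 3 dvd a" using assms(2,3) unfolding a_def by simp_all
      then have "a \<ge> 20 \<or> a = 8 \<or> a = 10 \<or> a = 14 \<or> a = 16" using a(2) by presburger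
      then show "a \<ge> 20 \<or> a \<in> {8, 10, 14, 16}" by simp
    qed
    finally show False by simp
  qed
qed

section \<open>The exponential equation\<close>

lemma equation_congruences:
  fixes n :: int
  assumes "(n - 1) ^ x + (n + 2) ^ y = n ^ z" "x > 0" "y > 0" "z > 0"
  shows "odd n" "\<not> 3 dvd n - 1" "n + 1 dvd (- 2) ^ x + 1 - (- 1) ^ z"
    "n dvd (- 1) ^ x + 2 ^ y"
proof -
  have "even ((n - 1) ^ x + (n + 2) ^ y) \<longleftrightarrow> even (n ^ z)" using assms(1) by simp
  then show "odd n" using assms(2-4) by auto
  show "\<not> 3 dvd n - 1"
  proof
    assume 3: "3 dvd n - 1"
    moreover have "n + 2 = (n - 1) + 3" by simp
    ultimately have "3 dvd n + 2" by (metis dvd_add dvd_refl)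
    then have "3 dvd (n + 2) ^ y" using assms(3) dvd_trans dvd_power by blast
    moreover have "3 dvd (n - 1) ^ x" using 3 assms(2) dvd_trans dvd_power by blast
    ultimately have "3 dvd (n - 1) ^ x + (n + 2) ^ y" by (rule dvd_add[rotated])
    then have "3 dvd n" unfolding assms(1) by (rule prime_dvd_power[rotated]) simp
    then show False using 3 by presburger
  qed
  have "[(n - 1) ^ x + (n + 2) ^ y = (- 2) ^ x + 1 ^ y] (mod n + 1)"
    by (intro cong_add cong_pow) (simp_all add: cong_iff_dvd_diff add.commute)
  moreover have "[n ^ z = (- 1) ^ z] (mod n + 1)"
    by (intro cong_pow) (simp add: cong_iff_dvd_diff)
  ultimately have "[(- 2) ^ x + 1 ^ y = (- 1) ^ z] (mod n + 1)"
    unfolding assms(1) by (meson cong_sym cong_trans)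
  then show "n + 1 dvd (- 2) ^ x + 1 - (- 1) ^ z" by (simp add: cong_iff_dvd_diff)
  have "[(n - 1) ^ x + (n + 2) ^ y = (- 1) ^ x + 2 ^ y] (mod n)"
    by (intro cong_add cong_pow) (simp_all add: cong_iff_dvd_diff)
  moreover have "n dvd n ^ z" using assms(4) by simp
  ultimately show "n dvd (- 1) ^ x + 2 ^ y" unfolding assms(1) by (simp add: cong_dvd_iff)
qed

text \<open>Modulo 4 decides \<open>y\<close>. An even \<open>z\<close> would make
  \<open>n + 1\<close> divide a power of 2, but it is twice an odd number greater than 1.\<close>

lemma exponent_parities_one_mod_four:
  fixes n :: int
  assumes "(n - 1) ^ x + (n + 2) ^ y = n ^ z" "x > 0" "y > 0" "z > 0" "n mod 4 = 1" "n \<ge> 2"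
  shows "even y" "odd z"
proof -
  have c: "[n - 1 = 0] (mod 4)" "[n + 2 = - 1] (mod 4)" "[n = 1] (mod 4)"
    using assms(5) by (auto simp: cong_def) presburger+
  have "[(n - 1) ^ x + (n + 2) ^ y = 0 ^ x + (- 1) ^ y] (mod 4)" "[n ^ z = 1 ^ z] (mod 4)"
    by (intro cong_add cong_pow c)+
  then have "[(- 1) ^ y = (1 :: int)] (mod 4)" using assms(2) unfolding assms(1)
    by (simp add: cong_def zero_power)
  then show "even y" by (cases "even y") (auto simp: cong_def)
  show "odd z"
  proof
    assume "even z"
    then have "n + 1 dvd (- 2) ^ x" using equation_congruences(3)[OF assms(1-4)] by simp
    then have "n + 1 dvd 2 ^ x" by (cases "even x") auto
    moreover obtain m where m: "n + 1 = 2 * m" "odd m"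
    proof
      show "n + 1 = 2 * ((n + 1) div 2)" "odd ((n + 1) div 2)" using assms(5) by presburger+
    qed
    ultimately have "m dvd 2 ^ x" by (metis dvd_mult_right)
    moreover have "coprime m (2 ^ x)" using m(2) by simp
    ultimately have "is_unit m" by (meson coprime_common_divisor dvd_refl)
    then show False using m(1) assms(6) by auto
  qed
qed

text \<open>For the even number \<open>t = n + 1\<close>, both \<open>t - 1\<close> and
  \<open>t + 1\<close> are square roots of 1 modulo \<open>2 t\<close>. Odd exponents thus act like
  exponent 1, and the equation becomes \<open>t = 0\<close> modulo \<open>2 t\<close>.\<close>

lemma even_exponent_three_mod_four:
  fixes n :: int
  assumes "n - 1 + (n + 2) ^ y = n ^ z" "n mod 4 = 3" "odd z" "n \<ge> 2"
  shows "even y"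
proof (rule ccontr)
  assume "odd y"
  define t where "t = n + 1"
  have "even t" using assms(2) unfolding t_def by presburger
  then obtain s where s: "t = 2 * s" by (elim evenE)
  have sq: "[w\<^sup>2 = 1] (mod 2 * t)" if "w = t + 1 \<or> w = t - 1" for w
  proof -
    have "(t + 1)\<^sup>2 - 1 = 2 * t * (s + 1)" "(t - 1)\<^sup>2 - 1 = 2 * t * (s - 1)"
      unfolding s by (simp_all add: algebra_simps power2_eq_square)
    then have "w\<^sup>2 - 1 = 2 * t * (s + 1) \<or> w\<^sup>2 - 1 = 2 * t * (s - 1)"
      using that by blast
    then show ?thesis by (auto simp: cong_iff_dvd_diff)
  qed
  have odd_pow: "[w ^ k = w] (mod 2 * t)" if w: "w = t + 1 \<or> w = t - 1" and k: "odd k" for w k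
  proof -
    obtain j where "k = 2 * j + 1" using k by (elim oddE)
    then have "w ^ k = (w\<^sup>2) ^ j * w" by (simp add: power_mult)
    moreover have "[(w\<^sup>2) ^ j * w = 1 ^ j * w] (mod 2 * t)"
      by (intro cong_mult cong_pow sq w cong_refl)
    ultimately show ?thesis by simp
  qed
  have "[n - 1 + (n + 2) ^ y = n - 1 + (n + 2)] (mod 2 * t)"
    by (intro cong_add cong_refl odd_pow \<open>odd y\<close>) (simp add: t_def)
  moreover have "[n ^ z = n] (mod 2 * t)" by (intro odd_pow assms(3)) (simp add: t_def)
  ultimately have "[n - 1 + (n + 2) = n] (mod 2 * t)" unfolding assms(1) by (meson cong_sym cong_trans)
  then have "2 * t dvd t" by (simp add: cong_iff_dvd_diff t_def)
  then show False using assms(4) by (auto simp: t_def dest!: zdvd_imp_le)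
qed

section \<open>Even \<open>z\<close>: factoring a difference of squares\<close>

text \<open>Half the sum \<open>p\<close> and half the difference \<open>q\<close> of
  \<open>n ^ Z\<close> and \<open>b ^ Y\<close> are coprime with product
  \<open>2 ^ (x - 2) * m ^ x\<close>. So the odd one is an \<open>x\<close>-th power and the other
  \<open>2 ^ (x - 2)\<close> times an \<open>x\<close>-th power; moreover
  \<open>p - q = b ^ Y\<close>.\<close>

lemma difference_of_squares_split:
  fixes n b m x Y Z :: nat
  assumes "n ^ (2 * Z) = b ^ (2 * Y) + (2 * m) ^ x" "odd m" "odd n" "odd b" "coprime n b" "x \<ge> 3"
  obtains u v where "u * v = m" "b ^ Y + 2 ^ (x - 2) * v ^ x = u ^ x \<or> b ^ Y + u ^ x = 2 ^ (x - 2) * v ^ x"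
proof -
  have "m > 0" using assms(2) by (cases m) auto
  have "b ^ (2 * Y) < n ^ (2 * Z)" using assms(1) \<open>m > 0\<close> by simp
  then have lt: "b ^ Y < n ^ Z" unfolding mult.commute[of 2] power_mult by (rule power_less_imp_less_base) simp
  have "even (n ^ Z - b ^ Y)" using assms(3,4) lt by simp
  then obtain q where q: "n ^ Z - b ^ Y = 2 * q" by (elim evenE)
  define p where "p = b ^ Y + q"
  have n: "n ^ Z = b ^ Y + 2 * q" using q lt by simp
  have x: "x = (x - 2) + 2" using assms(6) by simp
  have "(2 * m) ^ x + (b ^ Y)\<^sup>2 = (b ^ Y + 2 * q)\<^sup>2"
    using assms(1) unfolding n[symmetric] by (simp add: mult.commute flip: power_mult)
  also have "\<dots> = 4 * (p * q) + (b ^ Y)\<^sup>2"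
    by (simp add: p_def power2_eq_square algebra_simps)
  finally have "(2 * m) ^ x = 4 * (p * q)" by simp
  moreover have "(2 :: nat) ^ x = 4 * 2 ^ (x - 2)" by (subst x) (simp add: power_add)
  ultimately have "4 * (2 ^ (x - 2) * m ^ x) = 4 * (p * q)" by (simp add: power_mult_distrib mult.assoc)
  then have pq: "2 ^ (x - 2) * m ^ x = p * q" by simp
  have cop: "coprime p q"
  proof (rule coprimeI)
    fix d assume d: "d dvd p" "d dvd q"
    then have "d dvd b ^ Y" unfolding p_def by (simp add: dvd_add_left_iff)
    moreover have "d dvd n ^ Z" using calculation d(2) unfolding n by simp
    moreover have "coprime (n ^ Z) (b ^ Y)" using assms(5) by simp
    ultimately show "is_unit d" by (meson coprime_common_divisor)
  qed
  have main: "\<exists>u v. u * v = m \<and> o' = u ^ x \<and> e = 2 ^ (x - 2) * v ^ x"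
    if h: "odd o'" "2 ^ (x - 2) * m ^ x = o' * e" "coprime o' e" for o' e :: nat
  proof -
    have "coprime (2 ^ (x - 2)) o'" using h(1) by simp
    moreover have "2 ^ (x - 2) dvd o' * e" unfolding h(2)[symmetric] by simp
    ultimately have "2 ^ (x - 2) dvd e" by (simp add: coprime_dvd_mult_right_iff)
    then obtain e' where e': "e = 2 ^ (x - 2) * e'" ..
    have m: "m ^ x = o' * e'" using h(2) unfolding e' by simp
    have c: "coprime o' e'" using h(3) unfolding e' by simp
    have "is_nth_power x (o' * e')" unfolding m[symmetric] by simp
    then have "is_nth_power x o'" "is_nth_power x e'"
      using is_nth_power_mult_coprime_nat_iff[OF c] by blast+
    then obtain u v where uv: "o' = u ^ x" "e' = v ^ x" by (auto simp: is_nth_power_def)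
    have "(u * v) ^ x = m ^ x" using m uv by (simp add: power_mult_distrib)
    then have "u * v = m" using assms(6) by (simp add: power_eq_iff_eq_base)
    then show ?thesis using uv e' by auto
  qed
  have "odd (p + q)" using n assms(3) unfolding p_def by (metis even_power mult_2 add.assoc)
  then consider "odd p" | "odd q" by auto
  then show ?thesis
  proof cases
    case 1
    from main[OF this pq cop] obtain u v where "u * v = m" "p = u ^ x" "q = 2 ^ (x - 2) * v ^ x" by blast
    then show ?thesis using that[of u v] p_def by simp
  next
    case 2
    have "2 ^ (x - 2) * m ^ x = q * p" "coprime q p" using pq cop by (simp_all add: mult.commute coprime_commute)
    from main[OF 2 this] obtain u v where "u * v = m" "q = u ^ x" "p = 2 ^ (x - 2) * v ^ x" by blast
    then show ?thesis using that[of u v] p_def by simp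
  qed
qed

text \<open>\<open>u ^ x - 1\<close> is \<open>u - 1\<close> times a sum of \<open>x\<close> odd
  terms, which is odd.\<close>

lemma odd_power_cong_one:
  fixes u :: int
  assumes "odd x" "[u ^ x = 1] (mod 2 ^ k)" "k > 0"
  shows "[u = 1] (mod 2 ^ k)"
proof -
  have "2 dvd (2 :: int) ^ k" using assms(3) by simp
  then have "[u ^ x = 1] (mod 2)" using assms(2) cong_dvd_modulus by blast
  then have "odd u" using assms(1) by (auto simp: cong_def odd_pos)
  then have "[u = 1] (mod 2)" by (simp add: cong_def odd_iff_mod_2_eq_one)
  then have "[(\<Sum>i<x. u ^ i) = (\<Sum>i<x. 1 ^ i)] (mod 2)" by (intro cong_sum cong_pow)
  then have "odd (\<Sum>i<x. u ^ i)" using assms(1) by (simp add: cong_dvd_iff)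
  then have "coprime (2 ^ k) (\<Sum>i<x. u ^ i)" by simp
  moreover have "2 ^ k dvd (u - 1) * (\<Sum>i<x. u ^ i)"
    using assms(2) by (simp add: cong_iff_dvd_diff power_diff_1_eq)
  ultimately show ?thesis by (simp add: coprime_dvd_mult_left_iff cong_iff_dvd_diff)
qed

text \<open>Modulo \<open>2 ^ r - 1\<close> the exponent \<open>y\<close> reduces to
  \<open>j = y mod r\<close>. As \<open>2 ^ j + 1\<close> is smaller than the modulus, the sign must
  be negative and \<open>2 ^ j = 1\<close>.\<close>

lemma mersenne_exponents:
  fixes r x y :: nat
  assumes "r \<ge> 3" "(2 :: int) ^ r - 1 dvd (- 1) ^ x + 2 ^ y"
  shows "odd x" "r dvd y"
proof -
  let ?n = "(2 :: int) ^ r - 1"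
  define j where "j = y mod r"
  have "y = r * (y div r) + j" by (simp add: j_def)
  then have y: "(2 :: int) ^ y = (2 ^ r) ^ (y div r) * 2 ^ j" by (metis power_add power_mult)
  have "[2 ^ y = 1 ^ (y div r) * 2 ^ j] (mod ?n)"
    unfolding y by (intro cong_mult cong_pow cong_refl) (simp add: cong_iff_dvd_diff)
  then have "[(- 1) ^ x + 2 ^ y = (- 1) ^ x + 2 ^ j] (mod ?n)" by (intro cong_add cong_refl) simp
  then have d: "?n dvd (- 1) ^ x + 2 ^ j" using assms(2) by (simp add: cong_dvd_iff)
  have "j < r" using assms(1) by (simp add: j_def)
  then have "(2 :: int) ^ j \<le> 2 ^ (r - 1)" by (intro power_increasing) auto
  moreover have r: "(2 :: int) ^ r = 2 * 2 ^ (r - 1)" using assms(1) by (cases r) auto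
  moreover have "(4 :: int) \<le> 2 ^ (r - 1)"
    using power_increasing[of 2 "r - 1" "2 :: int"] assms(1) by simp
  ultimately have bound: "(2 :: int) ^ j + 1 < ?n" by linarith
  show "odd x"
  proof
    assume "even x"
    then have "?n dvd 2 ^ j + 1" using d by (simp add: add.commute)
    then have "?n \<le> 2 ^ j + 1" by (rule zdvd_imp_le) (simp add: add_pos_pos)
    then show False using bound by simp
  qed
  then have "?n dvd 2 ^ j - 1" using d by simp
  moreover have "0 \<le> (2 :: int) ^ j - 1" by simp
  ultimately have "(2 :: int) ^ j - 1 = 0" using bound zdvd_imp_le[of ?n "2 ^ j - 1"] by linarith
  then have "odd ((2 :: int) ^ j)" by simp
  then have "j = 0" by simp
  then show "r dvd y" by (simp add: j_def mod_eq_0_iff_dvd)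
qed

text \<open>Modulo \<open>2 ^ (r - 1)\<close> the split yields \<open>u = 1\<close> or
  \<open>u = -1\<close>. As \<open>u\<close> divides \<open>m = 2 ^ (r - 1) - 1\<close>, it is 1 or
  \<open>m\<close>, and both fail by size.\<close>

lemma no_solution_mersenne:
  fixes n r x y z :: nat
  assumes n: "n = 2 ^ r - 1" and r: "r \<ge> 3" and z: "even z"
    and pos: "x > 0" "y > 0" "z > 0" and eq: "(n - 1) ^ x + (n + 2) ^ y = n ^ z"
  shows False
proof -
  have "(2 :: nat) ^ 3 \<le> 2 ^ r" using r by (intro power_increasing) auto
  then have n7: "n \<ge> 7" by (simp add: n)
  have int_n: "int n = 2 ^ r - 1" unfolding n by (simp add: of_nat_diff)
  have "int ((n - 1) ^ x + (n + 2) ^ y) = int (n ^ z)" using eq by (simp only:)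
  then have eqi: "(int n - 1) ^ x + (int n + 2) ^ y = int n ^ z" using n7 by (simp add: of_nat_diff algebra_simps)
  have "even r"
  proof (rule ccontr)
    assume "odd r"
    have "[(2 :: int) ^ r = (- 1) ^ r] (mod 3)" by (intro cong_pow) (simp add: cong_def)
    then have "3 dvd (2 :: int) ^ r + 1" using \<open>odd r\<close> by (simp add: cong_iff_dvd_diff)
    then have "3 dvd ((2 :: int) ^ r + 1) - 3" by (rule dvd_diff) simp
    then have "3 dvd int n - 1" by (simp add: int_n)
    then show False using equation_congruences(2)[OF eqi pos] by simp
  qed
  have "(2 :: int) ^ r - 1 dvd (- 1) ^ x + 2 ^ y" using equation_congruences(4)[OF eqi pos] unfolding int_n .
  note x = mersenne_exponents[OF r this]
  from \<open>even r\<close> x(2) have "even y" by (rule dvd_trans)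
  have "int n + 1 dvd (- 2) ^ x" using equation_congruences(3)[OF eqi pos] z by simp
  moreover have "int n + 1 = 2 ^ r" by (simp add: int_n)
  ultimately have "(2 :: int) ^ r dvd (- 2) ^ x" by simp
  then have "(2 :: int) ^ r dvd 2 ^ x" using x(1) by simp
  then have "r \<le> x" by (simp add: dvd_power_iff)
  \<comment> \<open>The parities of \<open>r\<close> and \<open>x\<close> differ. The gain of one
    makes \<open>2 ^ (x - 2)\<close> vanish modulo \<open>2 ^ (r - 1)\<close>.\<close>
  then have rx: "r + 1 \<le> x" using x(1) \<open>even r\<close> by (cases "r = x") auto
  define m :: nat where "m = 2 ^ (r - 1) - 1"
  have r': "(2 :: nat) ^ r = 2 * 2 ^ (r - 1)" using r by (cases r) auto
  have n1: "n - 1 = 2 * m" unfolding n m_def r' by simp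
  have "even ((2 :: nat) ^ (r - 1))" using r by simp
  then have "odd m" unfolding m_def by simp
  have "odd n" unfolding n using r by simp
  have "coprime n (n + 2)"
  proof -
    have "coprime n 2" using \<open>odd n\<close> by simp
    moreover have "gcd n (n + 2) = gcd n 2" by (rule gcd_add2)
    ultimately show ?thesis by (simp only: coprime_iff_gcd_eq_1)
  qed
  obtain Y Z where YZ: "y = 2 * Y" "z = 2 * Z" using \<open>even y\<close> z by (elim evenE)
  have "n ^ (2 * Z) = (n + 2) ^ (2 * Y) + (2 * m) ^ x" using eq unfolding n1 YZ by simp
  then obtain u v where uv: "u * v = m"
    "(n + 2) ^ Y + 2 ^ (x - 2) * v ^ x = u ^ x \<or> (n + 2) ^ Y + u ^ x = 2 ^ (x - 2) * v ^ x"
    by (rule difference_of_squares_split) (use \<open>odd m\<close> \<open>odd n\<close> \<open>coprime n (n + 2)\<close> rx r in auto)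
  have u: "0 < u" "u \<le> m"
  proof -
    have "m > 0" using \<open>odd m\<close> by (cases m) auto
    then show "0 < u" "u \<le> m" using uv(1) by (auto intro: Nat.gr0I dvd_imp_le)
  qed
  let ?k = "r - 1"
  have "m < 2 ^ ?k" by (simp add: m_def)
  have b: "[(int n + 2) ^ Y = 1 ^ Y] (mod 2 ^ ?k)"
    unfolding int_n by (intro cong_pow) (simp add: cong_iff_dvd_diff le_imp_power_dvd)
  have e: "[2 ^ (x - 2) * int v ^ x = 0] (mod 2 ^ ?k)"
    using rx by (simp add: cong_iff_dvd_diff dvd_mult2 le_imp_power_dvd)
  from uv(2) show False
  proof
    assume h: "(n + 2) ^ Y + 2 ^ (x - 2) * v ^ x = u ^ x"
    then have "int ((n + 2) ^ Y + 2 ^ (x - 2) * v ^ x) = int (u ^ x)" by (simp only:)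
    then have h': "int u ^ x = (int n + 2) ^ Y + 2 ^ (x - 2) * int v ^ x" by (simp add: add.commute)
    have "[int u ^ x = 1] (mod 2 ^ ?k)" using cong_add[OF b e] unfolding h' by simp
    from odd_power_cong_one[OF x(1) this] r have "[int u = 1] (mod 2 ^ ?k)" by simp
    then have "int (2 ^ ?k) dvd int (u - 1)" using u(1) by (simp add: cong_iff_dvd_diff of_nat_diff)
    then have "2 ^ ?k dvd u - 1" by (simp only: int_dvd_int_iff)
    then have "u - 1 = 0" using u(2) \<open>m < 2 ^ ?k\<close> nat_dvd_not_less[of "u - 1" "2 ^ ?k"] by fastforce
    then have "u = 1" using u(1) by simp
    moreover have "v > 0" using uv(1) \<open>odd m\<close> by (intro Nat.gr0I) auto
    then have "0 < 2 ^ (x - 2) * v ^ x" by simp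
    moreover have "0 < (n + 2) ^ Y" by simp
    ultimately show False using h by (simp only: power_one)
  next
    assume h: "(n + 2) ^ Y + u ^ x = 2 ^ (x - 2) * v ^ x"
    then have "int ((n + 2) ^ Y + u ^ x) = int (2 ^ (x - 2) * v ^ x)" by (simp only:)
    then have "(int n + 2) ^ Y + int u ^ x = 2 ^ (x - 2) * int v ^ x" by (simp add: add.commute)
    then have h': "(- int u) ^ x = (int n + 2) ^ Y - 2 ^ (x - 2) * int v ^ x" using x(1) by simp
    have "[(- int u) ^ x = 1] (mod 2 ^ ?k)" using cong_diff[OF b e] unfolding h' by simp
    from odd_power_cong_one[OF x(1) this] r have "[- int u = 1] (mod 2 ^ ?k)" by simp
    then have "2 ^ ?k dvd - int u - 1" by (simp only: cong_iff_dvd_diff)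
    then have "2 ^ ?k dvd - (- int u - 1)" by (simp only: dvd_minus_iff)
    then have "int (2 ^ ?k) dvd int (u + 1)" by (simp add: add.commute)
    then have "2 ^ ?k dvd u + 1" by (simp only: int_dvd_int_iff)
    then have "2 ^ ?k \<le> u + 1" by (rule dvd_imp_le) simp
    then have "u = m" using u(2) by (simp add: m_def)
    then have "v = 1" using uv(1) u by simp
    have "m \<ge> 2" using n1 n7 by simp
    then have "2 ^ x \<le> u ^ x" unfolding \<open>u = m\<close> by (intro power_mono) auto
    moreover have "(2 :: nat) ^ (x - 2) \<le> 2 ^ x" by (intro power_increasing) auto
    moreover have "0 < (n + 2) ^ Y" by simp
    moreover have "(n + 2) ^ Y + u ^ x = 2 ^ (x - 2)" using h \<open>v = 1\<close> by simp
    ultimately show False by linarith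
  qed
qed

section \<open>The equation for \<open>n = 3\<close>\<close>

lemma two_plus_power_five:
  fixes y z :: nat
  assumes "2 + 5 ^ y = (3 :: nat) ^ z" "y > 0" "odd z"
  shows "y = 2 \<and> z = 3"
proof (cases "z < 4")
  case True
  then have "z = 1 \<or> z = 3" using assms(3) by (auto simp: less_Suc_eq numeral_eq_Suc)
  moreover have "z \<noteq> 1"
  proof
    assume "z = 1"
    moreover have "(5 :: nat) ^ 1 \<le> 5 ^ y" using assms(2) by (intro power_increasing) auto
    ultimately show False using assms(1) by simp
  qed
  ultimately have z: "z = 3" by blast
  then have "(5 :: nat) ^ y = 5 ^ 2" using assms(1) by simp
  then have "y = 2" by (subst (asm) power_inject_exp) auto
  with z show ?thesis by simp
next
  case False
  then have z: "z = 4 + (z - 4)" by simp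
  \<comment> \<open>Modulo \<open>81\<close> the equation determines \<open>y\<close> modulo \<open>54\<close>, a multiple of the order of \<open>5\<close> modulo \<open>109\<close>;
    the resulting value of \<open>3 ^ z\<close> modulo \<open>109\<close> is no power of \<open>3\<close>.\<close>
  have pw: "(5 :: nat) ^ y mod M = 5 ^ (y mod k) mod M" if "5 ^ k mod M = (1 :: nat)" for M k
  proof -
    have "(5 :: nat) ^ y = (5 ^ k) ^ (y div k) * 5 ^ (y mod k)"
      by (metis mult_div_mod_eq power_add power_mult)
    also have "\<dots> mod M = (5 ^ k mod M) ^ (y div k) * 5 ^ (y mod k) mod M"
      by (metis mod_mult_left_eq power_mod)
    finally show ?thesis using that by simp
  qed
  have "(3 :: nat) ^ z = 81 * 3 ^ (z - 4)" by (subst z) (simp only: power_add, simp)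
  then have e: "2 + 5 ^ y = 81 * (3 :: nat) ^ (z - 4)" using assms(1) by simp
  have mod3: "k mod 3 = 0 \<or> k mod 3 = 1 \<or> k mod 3 = 2" for k :: nat by presburger
  have c: "[5 ^ y = 79] (mod (81 :: nat))"
  proof -
    have "[2 + 5 ^ y = 2 + 79] (mod (81 :: nat))" unfolding e by (simp add: cong_def)
    then show ?thesis by (simp only: cong_add_lcancel_nat)
  qed
  have "[5 ^ y = 79] (mod (9 :: nat))" by (rule cong_dvd_modulus_nat[OF c]) simp
  then have "(5 :: nat) ^ y mod 9 = 7" by (simp add: cong_def)
  then have "(5 :: nat) ^ (y mod 6) mod 9 = 7" using pw[of 6 9] by simp
  moreover have "y mod 6 = 0 \<or> y mod 6 = 1 \<or> y mod 6 = 2 \<or> y mod 6 = 3 \<or> y mod 6 = 4 \<or> y mod 6 = 5"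
    by presburger
  ultimately have "y mod 6 = 2" by (elim disjE) simp_all
  then have y18: "y mod 18 = 2 \<or> y mod 18 = 8 \<or> y mod 18 = 14"
    using mod_mult2_eq[of y 6 3] mod3[of "y div 6"] by (elim disjE) simp_all
  have "[5 ^ y = 79] (mod (27 :: nat))" by (rule cong_dvd_modulus_nat[OF c]) simp
  then have "(5 :: nat) ^ y mod 27 = 25" by (simp add: cong_def)
  then have "(5 :: nat) ^ (y mod 18) mod 27 = 25" using pw[of 18 27] by simp
  then have "y mod 18 = 2" using y18 by (elim disjE) simp_all
  then have y54: "y mod 54 = 2 \<or> y mod 54 = 20 \<or> y mod 54 = 38"
    using mod_mult2_eq[of y 18 3] mod3[of "y div 18"] by (elim disjE) simp_all
  have "(5 :: nat) ^ y mod 81 = 79" using c by (simp add: cong_def)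
  then have "(5 :: nat) ^ (y mod 54) mod 81 = 79" using pw[of 54 81] by simp
  then have "y mod 54 = 20" using y54 by (elim disjE) simp_all
  then have "(5 :: nat) ^ y mod 109 = 5 ^ 20 mod 109" using pw[of 54 109] by simp
  then have "[5 ^ y = 35] (mod (109 :: nat))" by (simp add: cong_def)
  \<comment> \<open>The exponent 27 satisfies \<open>3 ^ 27 = 1\<close> modulo 109, whereas
    \<open>37 ^ 27\<close> is not 1.\<close>
  then have "[(2 + 5 ^ y) ^ 27 = (2 + 35) ^ 27] (mod (109 :: nat))"
    by (intro cong_pow cong_add cong_refl)
  moreover have "[((3 :: nat) ^ z) ^ 27 = 1] (mod 109)"
  proof -
    have "[((3 :: nat) ^ 27) ^ z = 1 ^ z] (mod 109)" by (intro cong_pow) (simp add: cong_def)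
    then show ?thesis by (simp only: power_one mult.commute flip: power_mult)
  qed
  ultimately have "[(2 + 35) ^ 27 = 1] (mod (109 :: nat))"
    unfolding assms(1) by (meson cong_sym cong_trans)
  then show ?thesis by (simp add: cong_def)
qed

text \<open>Modulo 3 the parities of \<open>x\<close> and \<open>y\<close> differ. For even
  \<open>y\<close> the split leaves \<open>5 ^ Y + 1 = 2 ^ (x - 2)\<close>, impossible modulo 4. For
  even \<open>x\<close> the two factors of \<open>5 ^ y\<close> are not both divisible by 5, so the
  smaller is 1, and residues modulo 8 leave \<open>h = 1\<close>.\<close>

lemma power_two_plus_power_five:
  fixes x y z :: nat
  assumes eq: "2 ^ x + 5 ^ y = (3 :: nat) ^ z" and pos: "y > 0" and x: "x \<ge> 2" and z: "even z"
  shows "x = 2 \<and> y = 1 \<and> z = 2"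
proof -
  obtain Z where Z: "z = 2 * Z" using z by (elim evenE)
  have eqi: "(2 :: int) ^ x + 5 ^ y = 3 ^ z"
  proof -
    have "int (2 ^ x + 5 ^ y) = int (3 ^ z)" using eq by (simp only:)
    then show ?thesis by simp
  qed
  have "(2 :: nat) ^ x \<ge> 1" "(5 :: nat) ^ y \<ge> 1" by simp_all
  then have "(2 :: nat) ^ x + 5 ^ y \<noteq> 1" by linarith
  then have "z > 0" unfolding eq by (cases "z = 0") simp_all
  have par: "even x \<longleftrightarrow> odd y"
  proof -
    have "[(2 :: int) ^ x + 5 ^ y = (- 1) ^ x + (- 1) ^ y] (mod 3)"
      by (intro cong_add cong_pow) (simp_all add: cong_def)
    moreover have "[(2 :: int) ^ x + 5 ^ y = 0] (mod 3)" unfolding eqi using \<open>z > 0\<close>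
      by (simp add: cong_0_iff)
    ultimately have "[(- 1) ^ x + (- 1) ^ y = (0 :: int)] (mod 3)" by (meson cong_sym cong_trans)
    then show ?thesis by (cases "even x"; cases "even y") (auto simp: cong_def)
  qed
  have p5: "(5 :: nat) ^ k mod 4 = 1" for k by (induction k) (auto simp: mod_mult_right_eq[symmetric] simp del: mod_mult_right_eq)
  show ?thesis
  proof (cases "even y")
    case True
    then obtain Y where Y: "y = 2 * Y" by (elim evenE)
    have x3: "x \<ge> 3" using par True x by (cases "x = 2") auto
    have "(3 :: nat) ^ (2 * Z) = 5 ^ (2 * Y) + (2 * 1) ^ x" using eq by (simp add: Y Z)
    then obtain u v :: nat where uv: "u * v = 1"
      "5 ^ Y + 2 ^ (x - 2) * v ^ x = u ^ x \<or> 5 ^ Y + u ^ x = 2 ^ (x - 2) * v ^ x"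
      by (rule difference_of_squares_split) (use x3 in \<open>auto intro: primes_coprime\<close>)
    then have "(5 :: nat) ^ Y + 2 ^ (x - 2) = 1 \<or> (5 :: nat) ^ Y + 1 = 2 ^ (x - 2)" by simp
    moreover have "(5 :: nat) ^ Y \<ge> 5" using power_increasing[of 1 Y "5 :: nat"] pos Y by simp
    ultimately have e: "(5 :: nat) ^ Y + 1 = 2 ^ (x - 2)" by linarith
    have "x - 2 \<ge> 2"
    proof (rule ccontr)
      assume "\<not> x - 2 \<ge> 2"
      then have "(2 :: nat) ^ (x - 2) \<le> 2 ^ 1" by (intro power_increasing) auto
      then show False using e \<open>(5 :: nat) ^ Y \<ge> 5\<close> by simp
    qed
    then have "(2 :: nat) ^ 2 dvd 2 ^ (x - 2)" by (rule le_imp_power_dvd)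
    then have "((5 :: nat) ^ Y + 1) mod 4 = 0" unfolding e by simp
    then show ?thesis using p5[of Y] by presburger
  next
    case False
    then obtain h where h: "x = 2 * h" using par by auto
    have sq: "((3 :: nat) ^ Z)\<^sup>2 = (2 ^ h)\<^sup>2 + 5 ^ y" using eq unfolding h Z by (simp add: mult.commute flip: power_mult)
    then have "((2 :: nat) ^ h)\<^sup>2 < (3 ^ Z)\<^sup>2" by simp
    then have lt: "(2 :: nat) ^ h < 3 ^ Z" by (rule power_less_imp_less_base) simp
    define d :: nat where "d = 3 ^ Z - 2 ^ h"
    have Zd: "3 ^ Z = d + 2 ^ h" using lt by (simp add: d_def)
    have prod: "d * (d + 2 * 2 ^ h) = 5 ^ y" using sq unfolding Zd
      by (simp add: power2_eq_square algebra_simps)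
    have p: "prime (5 :: nat)" by simp
    have "d dvd 5 ^ y" using prod by (metis dvd_triv_left)
    then obtain i where i: "d = 5 ^ i" using divides_primepow_nat[OF p] by blast
    have "i = 0"
    proof (rule ccontr)
      assume "i \<noteq> 0"
      then have "5 dvd d" by (simp add: i)
      have "d + 2 * 2 ^ h dvd 5 ^ y" using prod by (metis dvd_triv_right)
      then obtain j where j: "d + 2 * 2 ^ h = 5 ^ j" using divides_primepow_nat[OF p] by blast
      have "j \<noteq> 0"
      proof
        assume "j = 0"
        then have "d + 2 * 2 ^ h = 1" using j by (simp only: power_0)
        moreover have "0 < (2 :: nat) ^ h" by simp
        ultimately show False by linarith
      qed
      then have "5 dvd d + 2 * 2 ^ h" by (simp add: j)
      then have "5 dvd 2 * (2 :: nat) ^ h" using \<open>5 dvd d\<close> by (simp add: dvd_add_right_iff)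
      then have "5 dvd (2 :: nat) ^ Suc h" by simp
      then have "5 dvd (2 :: nat)" using p prime_dvd_power by blast
      then show False by simp
    qed
    then have d1: "d = 1" by (simp add: i)
    have e: "5 ^ y = 1 + (2 :: nat) ^ (h + 1)" using prod d1 by simp
    obtain k where k: "y = 2 * k + 1" using False by (elim oddE)
    have "(5 :: nat) ^ y mod 8 = 5"
    proof -
      have "[(25 :: nat) ^ k * 5 = 1 ^ k * 5] (mod 8)" by (intro cong_mult cong_pow) (simp_all add: cong_def)
      moreover have "(5 :: nat) ^ y = 25 ^ k * 5" by (simp add: k power_mult)
      ultimately show ?thesis by (simp add: cong_def)
    qed
    have "h + 1 < 3"
    proof (rule ccontr)
      assume "\<not> h + 1 < 3"
      then have "(2 :: nat) ^ 3 dvd 2 ^ (h + 1)" by (intro le_imp_power_dvd) simp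
      then have "(2 :: nat) ^ (h + 1) mod 8 = 0" by simp
      then show False using \<open>(5 :: nat) ^ y mod 8 = 5\<close> unfolding e by presburger
    qed
    moreover have "h > 0" using x h by simp
    ultimately have h1: "h = 1" by simp
    then have "(5 :: nat) ^ y = 5 ^ 1" using e by simp
    then have "y = 1" by (subst (asm) power_inject_exp) auto
    have "(3 :: nat) ^ Z = 3 ^ 1" using Zd d1 h1 by simp
    then have "Z = 1" by (subst (asm) power_inject_exp) auto
    then show ?thesis using \<open>y = 1\<close> h1 h Z by simp
  qed
qed

section \<open>Even \<open>x\<close>: sums of two squares\<close>

text \<open>For even \<open>U\<close> only the term \<open>r = h\<close> is odd, for even
  \<open>V\<close> only \<open>r = 0\<close>; the binomial coefficients there are 1 or
  \<open>2 h + 1\<close>.\<close>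

lemma odd_even_part_parity:
  fixes U V :: int
  assumes "odd (U + V)"
  shows "odd (odd_part h U V)" "odd (even_part h U V)"
proof -
  have split: "(\<Sum>r\<le>h. f r) = f h + (\<Sum>r<h. f r)" for f :: "nat \<Rightarrow> int"
    by (simp add: lessThan_Suc_atMost[symmetric] add.commute)
  have split0: "(\<Sum>r\<le>h. f r) = f 0 + (\<Sum>r=1..h. f r)" for f :: "nat \<Rightarrow> int"
    by (simp add: sum.atMost_shift atMost_atLeast0 sum.atLeast_Suc_atMost)
  have 1: "odd (odd_part h U V) \<and> odd (even_part h U V)" if "even U" "odd V"
  proof -
    have "even (\<Sum>r<h. of_nat ((2 * h + 1) choose (2 * r + 1)) * U ^ (h - r) * V ^ r)"
      "even (\<Sum>r<h. of_nat ((2 * h + 1) choose (2 * r)) * U ^ (h - r) * V ^ r)"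
      using that by (auto intro!: dvd_sum)
    then show ?thesis unfolding odd_part_def even_part_def split using that by simp
  qed
  have 2: "odd (odd_part h U V) \<and> odd (even_part h U V)" if "odd U" "even V"
  proof -
    have "even (\<Sum>r=1..h. of_nat ((2 * h + 1) choose (2 * r + 1)) * U ^ (h - r) * V ^ r)"
      "even (\<Sum>r=1..h. of_nat ((2 * h + 1) choose (2 * r)) * U ^ (h - r) * V ^ r)"
      using that by (auto intro!: dvd_sum)
    then show ?thesis unfolding odd_part_def even_part_def split0 using that by simp
  qed
  show "odd (odd_part h U V)" "odd (even_part h U V)" using 1 2 assms by auto
qed

text \<open>Up to sign, \<open>A\<close> is a coordinate of the Gaussian root times an odd cofactor.
  So \<open>2 ^ x\<close> divides that coordinate and \<open>4 ^ x <= n - 1\<close>, against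
  \<open>n + 1 <= 2 ^ x + 2\<close>.\<close>

lemma even_x_impossible:
  fixes n :: int
  assumes eq: "(n - 1) ^ x + (n + 2) ^ y = n ^ z" and pos: "x > 0" "y > 0" "z > 0"
    and n: "n mod 4 = 1" "n \<ge> 2" and "even x"
  shows False
proof -
  have "even y" "odd z" using exponent_parities_one_mod_four[OF eq pos n] by auto
  then obtain Y h where Y: "y = 2 * Y" and h: "z = 2 * h + 1" by (elim evenE oddE)
  obtain k where k: "x = 2 * k" using \<open>even x\<close> by (elim evenE)
  define A where "A = (n - 1) ^ k"
  define B where "B = (n + 2) ^ Y"
  have AB: "B\<^sup>2 + A\<^sup>2 = n ^ z"
    using eq unfolding A_def B_def k Y by (simp add: mult.commute flip: power_mult)
  have "coprime (n - 1) n" by (metis coprime_commute coprime_diff_one_left)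
  then have "coprime A n" by (simp add: A_def)
  have "n > 0" using n(2) by simp
  obtain u v a b where uv: "u\<^sup>2 + v\<^sup>2 = n" "a\<^sup>2 + b\<^sup>2 = 1" "qemb 1 B A = qemb 1 u v ^ z * qemb 1 a b"
    using gaussian_power_root[OF \<open>n > 0\<close> \<open>coprime A n\<close> AB pos(3)] by blast
  define e where "e = even_part h (u\<^sup>2) (- (1 * v\<^sup>2))"
  define d where "d = odd_part h (u\<^sup>2) (- (1 * v\<^sup>2))"
  have "qemb 1 B A = qemb 1 (u * e * a - v * d * b) (u * e * b + v * d * a)"
    unfolding uv(3) h qemb_power_odd[OF zero_le_one] e_def d_def by (simp add: qemb_mult)
  then have B: "B = u * e * a - v * d * b" and A: "A = u * e * b + v * d * a"
    by (simp_all add: qemb_eq_iff)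
  have "odd n" by (rule equation_congruences(1)[OF eq pos])
  then have "odd (u\<^sup>2 + - (1 * v\<^sup>2))" using uv(1) by auto
  then have odd: "odd e" "odd d" unfolding e_def d_def by (rule odd_even_part_parity)+
  have ab: "(\<bar>a\<bar> = 1 \<and> b = 0) \<or> (a = 0 \<and> \<bar>b\<bar> = 1)"
  proof (cases "a = 0")
    case True
    then show ?thesis using uv(2) by (simp add: power2_eq_1_iff abs_if) auto
  next
    case False
    then have "a\<^sup>2 \<ge> 1" by (simp add: int_one_le_iff_zero_less)
    then have "b\<^sup>2 \<le> 0" using uv(2) by linarith
    then show ?thesis using uv(2) by (auto simp: power2_eq_1_iff)
  qed
  have 4: "4 dvd n - 1" using n(1) by presburger
  then have "4 ^ k dvd A" unfolding A_def by (rule dvd_power_same)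
  then have xA: "2 ^ x dvd A" by (simp add: k power_mult)
  have "even A" using xA pos(1) by (meson dvd_power dvd_trans)
  have "A \<noteq> 0" using n(2) by (simp add: A_def)
  \<comment> \<open>The units \<open>i\<close> and \<open>- i\<close> swap the coordinates:
    \<open>w\<close> is \<open>u\<close> for them and \<open>v\<close> for 1 and -1.\<close>
  obtain w w' c where w: "\<bar>A\<bar> = \<bar>w * c\<bar>" "odd c" "w\<^sup>2 + w'\<^sup>2 = n"
  proof (cases "b = 0")
    case True
    then have "\<bar>A\<bar> = \<bar>v * d\<bar>" using ab A by (auto simp: abs_mult)
    then show ?thesis using that[of v d u] odd uv(1) by (simp add: add.commute)
  next
    case False
    then have "\<bar>A\<bar> = \<bar>u * e\<bar>" using ab A by (auto simp: abs_mult)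
    then show ?thesis using that[of u e v] odd uv(1) by simp
  qed
  have "2 ^ x dvd w * c" using xA w(1) by (metis abs_dvd_iff dvd_abs_iff)
  moreover have "coprime (2 ^ x) c" using w(2) by simp
  ultimately have dw: "2 ^ x dvd w" by (simp add: coprime_dvd_mult_left_iff)
  have "w \<noteq> 0" using w(1) \<open>A \<noteq> 0\<close> by auto
  then have "2 ^ x \<le> \<bar>w\<bar>" using dw by (simp add: zdvd_imp_le)
  then have "2 ^ x * 2 ^ x \<le> \<bar>w\<bar> * \<bar>w\<bar>" by (intro mult_mono) auto
  then have "2 ^ x * 2 ^ x \<le> w\<^sup>2" by (simp add: power2_eq_square)
  moreover have "w'\<^sup>2 \<noteq> 0"
  proof
    assume "w'\<^sup>2 = 0"
    then have "even n" using w(3) dw pos(1) by (auto dest!: dvd_trans[of 2 "2 ^ x" w, rotated])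
    then show False using \<open>odd n\<close> by simp
  qed
  then have "w'\<^sup>2 \<ge> 1" by (simp add: int_one_le_iff_zero_less)
  ultimately have 1: "2 ^ x * 2 ^ x \<le> n - 1" using w(3) by linarith
  have "n + 1 dvd 2 ^ x + 2" using equation_congruences(3)[OF eq pos] \<open>even x\<close> \<open>odd z\<close> by (simp add: add.commute)
  then have "n + 1 \<le> 2 ^ x + 2" by (rule zdvd_imp_le) (simp add: add_pos_pos)
  then have "2 ^ x * 2 ^ x \<le> (2 :: int) ^ x" using 1 by linarith
  moreover have "(2 :: int) ^ 1 \<le> 2 ^ x" using pos(1) by (intro power_increasing) auto
  then have "2 * 2 ^ x \<le> (2 :: int) ^ x * 2 ^ x" by (intro mult_right_mono) auto
  ultimately show False by (simp add: \<open>(2 :: int) ^ 1 \<le> 2 ^ x\<close>)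
qed

section \<open>Odd \<open>x\<close>\<close>

text \<open>Modulo \<open>n + 2\<close> the equation says \<open>3 ^ x = 2 ^ z\<close> with odd
  exponents; doubling and dividing by the square of \<open>3 ^ i\<close> exhibits 6 as a
  square.\<close>

lemma six_square_mod:
  fixes n :: int
  assumes "(n - 1) ^ x + (n + 2) ^ y = n ^ z" "y > 0" "odd x" "odd z" "\<not> 3 dvd n + 2"
  obtains c where "n + 2 dvd c\<^sup>2 - 6"
proof -
  let ?b = "n + 2"
  obtain i j where ij: "x = 2 * i + 1" "z = 2 * j + 1" using assms(3,4) by (elim oddE)
  have "[(n - 1) ^ x + ?b ^ y = (- 3) ^ x + 0 ^ y] (mod ?b)"
    by (intro cong_add cong_pow) (simp_all add: cong_iff_dvd_diff add.commute)
  moreover have "[n ^ z = (- 2) ^ z] (mod ?b)"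
    by (intro cong_pow) (simp add: cong_iff_dvd_diff)
  ultimately have "[(- 3) ^ x = (- 2) ^ z] (mod ?b)"
    unfolding assms(1) using assms(2) by (simp add: zero_power) (meson cong_sym cong_trans)
  then have "[- ((- 3) ^ x) = - ((- 2) ^ z)] (mod ?b)" by (simp only: cong_minus_minus_iff)
  then have e: "[3 * (3 ^ i)\<^sup>2 = 2 * (2 ^ j)\<^sup>2] (mod ?b)"
    unfolding ij by (simp add: power_mult mult.commute flip: power_mult)
  have "prime (3 :: int)" by simp
  then have "coprime 3 ?b" using assms(5) by (simp add: prime_imp_coprime)
  then have "coprime (3 ^ i) ?b" by simp
  then obtain s where s: "[3 ^ i * s = 1] (mod ?b)" using cong_solve_coprime_int by blast
  have "[2 * (2 * (2 ^ j)\<^sup>2) * s\<^sup>2 = 2 * (3 * (3 ^ i)\<^sup>2) * s\<^sup>2] (mod ?b)"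
    by (intro cong_mult cong_refl cong_sym[OF e])
  also have "2 * (3 * (3 ^ i)\<^sup>2) * s\<^sup>2 = 6 * (3 ^ i * s)\<^sup>2" by (simp add: power_mult_distrib)
  also have "[\<dots> = 6 * 1\<^sup>2] (mod ?b)" by (intro cong_mult cong_pow s cong_refl)
  finally have "[2 * (2 * (2 ^ j)\<^sup>2) * s\<^sup>2 = 6] (mod ?b)" by simp
  moreover have "2 * (2 * (2 ^ j)\<^sup>2) * s\<^sup>2 = (2 * 2 ^ j * s)\<^sup>2" by (simp add: power_mult_distrib)
  ultimately show ?thesis using that by (simp add: cong_iff_dvd_diff)
qed

text \<open>Of the residues 5, 9, 17 and 21 of \<open>n\<close> modulo 24 possible for
  \<open>n mod 4 = 1\<close>, only 5 is not covered by \<open>no_prime_power_root\<close>; it is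
  removed first, where \<open>n + 2\<close> is 7 modulo 24.\<close>

lemma odd_x_impossible:
  fixes n x y z :: nat
  assumes eq: "(n - 1) ^ x + (n + 2) ^ y = n ^ z" and pos: "x > 0" "y > 0" "z > 0"
    and n: "n \<ge> 2" and par: "odd x" "even y" "odd z"
    and cases: "n mod 4 = 1 \<or> n mod 4 = 3 \<and> x = 1 \<and> n > 3"
  shows False
proof -
  define D where "D = int n - 1"
  have "int ((n - 1) ^ x + (n + 2) ^ y) = int (n ^ z)" using eq by (simp only:)
  then have eqi: "(int n - 1) ^ x + (int n + 2) ^ y = int n ^ z"
    using n by (simp add: of_nat_diff algebra_simps)
  note facts = equation_congruences[OF eqi pos]
  have D3: "\<not> 3 dvd D" using facts(2) by (simp add: D_def)
  have b3: "\<not> 3 dvd int n + 2" using facts(2) by presburger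
  have "n mod 24 \<noteq> 5"
  proof
    assume "n mod 24 = 5"
    then have "(int n + 2) mod 24 = 7" by presburger
    then show False using six_square_mod[OF eqi pos(2) par(1,3) b3] six_not_square_mod[of "int n + 2"] by auto
  qed
  have "odd n" using facts(1) by simp
  have n3: "\<not> 3 dvd n - 1" using facts(2) n by presburger
  have n9: "n \<ge> 9"
  proof (rule ccontr)
    assume "\<not> n \<ge> 9"
    then have "n = 2 \<or> n = 3 \<or> n = 4 \<or> n = 5 \<or> n = 6 \<or> n = 7 \<or> n = 8" using n by linarith
    then show False using cases \<open>n mod 24 \<noteq> 5\<close> n3 by (elim disjE) simp_all
  qed
  have "n \<le> z + 2" by (rule exponent_lower_bound[OF n9 n3 \<open>odd n\<close> pos(2) eq])
  then have Dz: "D - 1 \<le> int z" by (simp add: D_def)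
  obtain g Y0 where g: "x = 2 * g + 1" and Y0: "y = 2 * Y0" using par(1,2) by (elim oddE evenE)
  define A where "A = D ^ g"
  define B where "B = (int n + 2) ^ Y0"
  have AB: "B\<^sup>2 + D * A\<^sup>2 = int n ^ z"
    using eqi unfolding A_def B_def g Y0 D_def[symmetric] by (simp add: power_add mult.commute add.commute flip: power_mult)
  have nD: "int n = D + 1" by (simp add: D_def)
  have copD: "coprime (int n) D" unfolding nD by (simp add: coprime_commute)
  then have cop2D: "coprime (int n) (2 * D)" using \<open>odd n\<close> by simp
  have copA: "coprime A (int n)" unfolding A_def using copD by (simp add: coprime_commute)
  have D8: "D \<ge> 8" using n9 by (simp add: D_def)
  have "int n > 0" using n by simp
  obtain q M X Y where q: "prime q" "odd q" "z = M * q" "X\<^sup>2 + D * Y\<^sup>2 = int n ^ M"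
    and root: "qemb D B A = qemb D X Y ^ q \<or> qemb D B A = - (qemb D X Y ^ q)"
    by (rule odd_prime_power_root[OF D8 \<open>int n > 0\<close> cop2D copA AB Dz par(3)])
  obtain h where h: "q = 2 * h + 1" using q(2) by (elim oddE)
  define e where "e = even_part h (X\<^sup>2) (- (D * Y\<^sup>2))"
  define d where "d = odd_part h (X\<^sup>2) (- (D * Y\<^sup>2))"
  have D0: "D \<ge> 0" "D > 0" using D8 by auto
  have "B = X * e \<and> A = Y * d \<or> B = - (X * e) \<and> A = - (Y * d)"
    using root unfolding h qemb_power_odd[OF D0(1)] e_def[symmetric] d_def[symmetric] qemb_uminus
    by (simp only: qemb_eq_iff[OF D0(2)])
  then have XB: "X dvd B" and Yd: "\<bar>Y * d\<bar> = \<bar>A\<bar>" by auto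
  have YA: "\<bar>Y * odd_part h (X\<^sup>2) (- (D * Y\<^sup>2))\<bar> = D ^ g" using Yd D0 by (simp add: d_def A_def)
  have "prime (3 :: int)" by simp
  then have "coprime 3 D" using D3 by (rule prime_imp_coprime)
  then have "coprime (int n + 2) D"
  proof -
    have "int n + 2 = 3 + D" by (simp add: D_def)
    moreover have "gcd (3 + D) D = gcd 3 D" by (rule gcd_add1)
    ultimately show ?thesis using \<open>coprime 3 D\<close> by (simp only: coprime_iff_gcd_eq_1)
  qed
  then have "coprime B D" by (simp add: B_def)
  then have copX: "coprime X D" using XB by (metis coprime_divisors dvd_refl)
  have X3: "3 dvd int n \<longrightarrow> \<not> 3 dvd X"
  proof (intro impI notI)
    assume "3 dvd int n" "3 dvd X"
    then have "3 dvd B" using XB by (meson dvd_trans)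
    then have "3 dvd int n + 2" unfolding B_def using \<open>prime 3\<close> prime_dvd_power by blast
    then show False using b3 by simp
  qed
  have "even D" using \<open>odd n\<close> by (simp add: D_def)
  have "odd M" using par(3) q(3) by simp
  have c: "4 dvd D \<and> (3 dvd int n \<or> int n mod 24 = 17) \<or> D mod 4 = 2 \<and> g = 0 \<and> D > 2"
    using cases
  proof
    assume n1: "n mod 4 = 1"
    have "4 dvd D" unfolding D_def using n1 by presburger
    moreover have "3 dvd int n \<or> int n mod 24 = 17"
    proof -
      define r where "r = n mod 24"
      have "r mod 3 = n mod 3" "r mod 4 = n mod 4" unfolding r_def by (simp_all add: mod_mod_cancel)
      moreover have "n mod 3 \<noteq> 1" using n3 n by presburger
      ultimately have "r mod 3 \<noteq> 1" "r = 4 * (r div 4) + 1"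
        using n1 by (simp, metis mult_div_mod_eq)
      moreover have "r div 4 < 6" unfolding r_def by (simp add: div_less_iff_less_mult)
      then have "r div 4 = 0 \<or> r div 4 = 1 \<or> r div 4 = 2 \<or> r div 4 = 3 \<or> r div 4 = 4 \<or> r div 4 = 5"
        by linarith
      ultimately have "r mod 3 = 0 \<or> r = 5 \<or> r = 17" by (elim disjE) simp_all
      then have "n mod 3 = 0 \<or> n mod 24 = 17"
        using \<open>r mod 3 = n mod 3\<close> \<open>n mod 24 \<noteq> 5\<close> by (auto simp: r_def)
      then show ?thesis by presburger
    qed
    ultimately show ?thesis by blast
  next
    assume "n mod 4 = 3 \<and> x = 1 \<and> n > 3"
    moreover from this have "D mod 4 = 2" unfolding D_def by presburger
    ultimately show ?thesis using g by (simp add: D_def)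
  qed
  show False
    by (rule no_prime_power_root[OF nD q(1)[unfolded h] q(4) \<open>odd M\<close> copX \<open>even D\<close> D3 X3 YA c])
qed

section \<open>Assembling the cases\<close>

theorem theorem1p1:
  fixes n x y z :: nat
  assumes "n \<ge> 2" and "x > 0" and "y > 0" and "z > 0"
  shows "(n - 1) ^ x + (n + 2) ^ y = n ^ z \<longleftrightarrow>
    (n, x, y, z) \<in> {(3, 2, 1, 2), (3, 1, 2, 3)}"
proof
  assume "(n, x, y, z) \<in> {(3, 2, 1, 2), (3, 1, 2, 3)}"
  then show "(n - 1) ^ x + (n + 2) ^ y = n ^ z" by auto
next
  assume eq: "(n - 1) ^ x + (n + 2) ^ y = n ^ z"
  note pos = assms(2-4)
  have "int ((n - 1) ^ x + (n + 2) ^ y) = int (n ^ z)" using eq by (simp only:)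
  then have eqi: "(int n - 1) ^ x + (int n + 2) ^ y = int n ^ z"
    using assms(1) by (simp add: of_nat_diff algebra_simps)
  note facts = equation_congruences[OF eqi pos]
  have "odd n" using facts(1) by simp
  then have "n mod 4 = 1 \<or> n mod 4 = 3" by presburger
  then consider "n mod 4 = 1" | "n mod 4 = 3" by blast
  then show "(n, x, y, z) \<in> {(3, 2, 1, 2), (3, 1, 2, 3)}"
  proof cases
    case 1
    have n: "int n mod 4 = 1" "int n \<ge> 2" using 1 assms(1) by presburger+
    have "odd x" using even_x_impossible[OF eqi pos n] by blast
    then show ?thesis
      using odd_x_impossible[OF eq pos assms(1)] exponent_parities_one_mod_four[OF eqi pos n] 1 by blast
  next
    case 2
    have n: "int n mod 4 = 3" "int n \<ge> 2" using 2 assms(1) by presburger+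
    have "[int n - 1 = 2] (mod 4)" "[int n + 2 = 1] (mod 4)" "[int n = - 1] (mod 4)"
      using n(1) by (simp_all add: cong_def) presburger+
    then have "[(int n - 1) ^ x + (int n + 2) ^ y = 2 ^ x + 1 ^ y] (mod 4)" "[int n ^ z = (- 1) ^ z] (mod 4)"
      by (auto intro!: cong_add cong_pow simp del: power_one)
    \<comment> \<open>This makes \<open>z\<close> odd for \<open>x = 1\<close> and even for
      \<open>x >= 2\<close>.\<close>
    then have mod4: "[2 ^ x + 1 = (- 1 :: int) ^ z] (mod 4)"
      unfolding eqi power_one by (meson cong_sym cong_trans)
    show ?thesis
    proof (cases "x = 1")
      case True
      have "odd z"
      proof
        assume "even z"
        then show False using mod4 True by (simp add: cong_def)
      qed
      moreover have "even y" by (rule even_exponent_three_mod_four[OF _ n(1) \<open>odd z\<close> n(2)]) (use eqi True in simp)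
      moreover have "n = 3"
      proof (rule ccontr)
        assume "n \<noteq> 3"
        then have "n > 3" using 2 by (cases "n < 3") auto
        then show False using odd_x_impossible[OF eq pos assms(1)] True 2 \<open>odd z\<close> \<open>even y\<close> by simp
      qed
      moreover have "2 + 5 ^ y = (3 :: nat) ^ z" using eq True \<open>n = 3\<close> by simp
      ultimately show ?thesis using two_plus_power_five[of y z] pos True by simp
    next
      case False
      then have x2: "x \<ge> 2" using pos(1) by simp
      then have "(2 :: int) ^ 2 dvd 2 ^ x" by (rule le_imp_power_dvd)
      have "even z"
      proof (rule ccontr)
        assume "odd z"
        then have "4 dvd (2 :: int) ^ x + 2" using mod4 by (simp add: cong_iff_dvd_diff add.commute)
        then show False using \<open>(2 :: int) ^ 2 dvd 2 ^ x\<close> by (simp add: dvd_add_right_iff)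
      qed
      then have "int n + 1 dvd (- 2) ^ x" using facts(3) by simp
      then have "int (n + 1) dvd int (2 ^ x)" by (cases "even x") (auto simp: add.commute)
      then have "n + 1 dvd 2 ^ x" by (simp only: int_dvd_int_iff)
      then obtain r where r: "n + 1 = 2 ^ r" using divides_primepow_nat[OF two_is_prime_nat] by blast
      then have nr: "n = 2 ^ r - 1" by (metis add_diff_cancel_right')
      have "\<not> r \<ge> 3" using no_solution_mersenne[OF nr _ \<open>even z\<close> pos eq] by blast
      then have "r = 0 \<or> r = 1 \<or> r = 2" by linarith
      then have "n = 3" using nr assms(1) by auto
      then have "2 ^ x + 5 ^ y = (3 :: nat) ^ z" using eq by simp
      then show ?thesis using power_two_plus_power_five[of x y z] pos(2) x2 \<open>even z\<close> \<open>n = 3\<close> by simp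
    qed
  qed
qed

end
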